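(* Let $\mathcal X$ be an infinite dimensional complex Banach space and let $A\in B(\mathcal X)$. Let $L_A\in B(B(\mathcal X))$ be the operator $L_A(T)=AT$. Then the following statements are equivalent: (i) $A$ satisfies generalized $a$-Weyl's theorem and $\Pi^a(A)=\Pi^a(L_A)$. (ii) $L_A$ satisfies generalized $a$-Weyl's theorem and $A$ satisfies $a$-Browder's theorem.
   Context: For a complex Banach space $\mathcal Z$, $B(\mathcal Z)$ is the Banach algebra of bounded linear operators on $\mathcal Z$. For $T\in B(\mathcal Z)$, $N(T)$, $R(T)$ are the null space and range; $T-\lambda$ means $T-\lambda I$; $\alpha(T)=\dim N(T)$, $\beta(T)=\dim \mathcal Z/R(T)$. $T$ is bounded below if $N(T)=0$ and $R(T)$ is closed; $\sigma_a(T)=\{\lambda\in\mathbb C:T-\lambda\text{ is not bounded below}\}$. $T$ is upper semi-Fredholm if $R(T)$ is closed and $\alpha(T)<\infty$, with index $\mathrm{ind}(T)=\alpha(T)-\beta(T)\in\mathbb Z\cup\{-\infty\}$. $\sigma_{aw}(T)=\{\lambda\in\sigma_a(T): T-\lambda\text{ is not upper semi-Fredholm or }0<\mathrm{ind}(T-\lambda)\}$. $T$ is upper semi B-Fredholm if for some $n\in\mathbb N$ the range $R(T^n)$ is closed and the induced operator $T_n=T|_{R(T^n)}\in B(R(T^n))$ is upper semi-Fredholm; its index is $\mathrm{ind}(T)=\mathrm{ind}(T_n)$ (independent of such $n$). $\sigma_{SBF_+^-}(T)=\{\lambda\in\mathbb C: T-\lambda\text{ is not upper semi B-Fredholm or }0<\mathrm{ind}(T-\lambda)\}$.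 The ascent $\mathrm{asc}(T)$ is the smallest non-negative integer $n$ with $N(T^n)=N(T^{n+1})$, or $\infty$ if none exists. For $K\subseteq\mathbb C$, $\mathrm{iso}\,K$ is the set of isolated points of $K$. $\Pi^a(T)=\{\lambda\in\mathrm{iso}\,\sigma_a(T): a=\mathrm{asc}(T-\lambda)<\infty\text{ and }R((T-\lambda)^{a+1})\text{ is closed}\}$, $\Pi^a_0(T)=\{\lambda\in\Pi^a(T):\alpha(T-\lambda)<\infty\}$, and $E^a(T)=\{\lambda\in\mathrm{iso}\,\sigma_a(T):0<\alpha(T-\lambda)\}$. $T$ satisfies $a$-Browder's theorem if $\sigma_{aw}(T)=\sigma_a(T)\setminus\Pi^a_0(T)$. $T$ satisfies generalized $a$-Weyl's theorem if $\sigma_{SBF_+^-}(T)=\sigma_a(T)\setminus E^a(T)$. *)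

theory Defs
  imports "HOL-Analysis.Analysis"
begin

section \<open>Complex Banach spaces\<close>

text \<open>The real structure of a complex normed space is the one obtained by restricting scalars
  (\<open>scaleR_eq_scaleC\<close>).\<close>

class complex_normed_vector = real_normed_vector +
  fixes scaleC :: "complex \<Rightarrow> 'a \<Rightarrow> 'a"  (infixr \<open>*\<^sub>C\<close> 75)
  assumes scaleC_add_right: "c *\<^sub>C (x + y) = c *\<^sub>C x + c *\<^sub>C y"
    and scaleC_add_left: "(c + d) *\<^sub>C x = c *\<^sub>C x + d *\<^sub>C x"
    and scaleC_scaleC: "c *\<^sub>C d *\<^sub>C x = (c * d) *\<^sub>C x"
    and scaleR_eq_scaleC: "r *\<^sub>R x = complex_of_real r *\<^sub>C x"
    and norm_scaleC: "norm (c *\<^sub>C x) = cmod c * norm x"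

class complex_banach = complex_normed_vector + banach

lemma scaleC_one: "1 *\<^sub>C x = (x :: 'a :: complex_normed_vector)"
  using scaleR_eq_scaleC[of 1 x] by simp

global_interpretation complex_vector:
  vector_space "scaleC :: complex \<Rightarrow> 'a \<Rightarrow> 'a :: complex_normed_vector"
  defines cdependent = complex_vector.dependent
    and cspan = complex_vector.span
    and csubspace = complex_vector.subspace
    and cdim_nat = complex_vector.dim
  by unfold_locales (auto simp: scaleC_add_right scaleC_add_left scaleC_scaleC scaleC_one)

lemma scaleC_left_commute:
  "c *\<^sub>C d *\<^sub>C x = d *\<^sub>C c *\<^sub>C (x :: 'a :: complex_normed_vector)"
  by (simp add: scaleC_scaleC mult.commute)

lemma bounded_linear_scaleC:
  "bounded_linear (\<lambda>x. c *\<^sub>C (x :: 'a :: complex_normed_vector))"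
proof (rule bounded_linear_intro[of _ "cmod c"])
  show "c *\<^sub>C r *\<^sub>R x = r *\<^sub>R c *\<^sub>C x" for r and x :: 'a
    by (simp only: scaleR_eq_scaleC scaleC_left_commute)
qed (simp_all add: scaleC_add_right norm_scaleC)


section \<open>The Banach algebra of bounded operators\<close>

typedef (overloaded) 'a bop =
  "{f :: 'a :: complex_normed_vector \<Rightarrow> 'a.
      bounded_linear f \<and> (\<forall>c x. f (c *\<^sub>C x) = c *\<^sub>C f x)}"
  morphisms bop_apply Bop
  by (rule exI[of _ "\<lambda>x. x"]) simp

declare [[coercion "bop_apply :: 'a :: complex_normed_vector bop \<Rightarrow> 'a \<Rightarrow> 'a"]]

setup_lifting type_definition_bop

lemma bop_eqI: "(\<And>x. bop_apply S x = bop_apply T x) \<Longrightarrow> S = T"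
  by transfer auto

lemma bounded_linear_bop_apply: "bounded_linear (bop_apply T)"
  using bop_apply[of T] by simp

lemma bop_apply_scaleC: "bop_apply T (c *\<^sub>C x) = c *\<^sub>C bop_apply T x"
  using bop_apply[of T] by simp

lemma onorm_scaleC:
  fixes f :: "'a :: complex_normed_vector \<Rightarrow> 'b :: complex_normed_vector"
  assumes "bounded_linear f"
  shows "onorm (\<lambda>x. c *\<^sub>C f x) = cmod c * onorm f"
proof (cases "c = 0")
  case False
  have le: "onorm (\<lambda>x. d *\<^sub>C g x) \<le> cmod d * onorm g"
    if g: "bounded_linear g" for d and g :: "'a \<Rightarrow> 'b"
  proof (rule onorm_bound)
    show "norm (d *\<^sub>C g x) \<le> cmod d * onorm g * norm x" for x
      using mult_left_mono[OF onorm[OF g, of x], of "cmod d"]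
      by (simp add: norm_scaleC mult.assoc)
  qed (simp add: onorm_pos_le g)
  have "bounded_linear (\<lambda>x. c *\<^sub>C f x)"
    by (rule bounded_linear_compose[OF bounded_linear_scaleC assms])
  from le[OF this, of "inverse c"] False
  have "onorm f \<le> inverse (cmod c) * onorm (\<lambda>x. c *\<^sub>C f x)"
    by (simp add: scaleC_scaleC scaleC_one norm_inverse)
  with False have "cmod c * onorm f \<le> onorm (\<lambda>x. c *\<^sub>C f x)"
    by (simp add: field_simps)
  with le[OF assms, of c] show ?thesis by simp
qed (simp add: onorm_zero)

instantiation bop :: (complex_normed_vector) complex_normed_vector
begin

lift_definition norm_bop :: "'a bop \<Rightarrow> real" is onorm .

lift_definition minus_bop :: "'a bop \<Rightarrow> 'a bop \<Rightarrow> 'a bop" is "\<lambda>f g x. f x - g x"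
  by (simp add: bounded_linear_sub complex_vector.scale_right_diff_distrib)

lift_definition uminus_bop :: "'a bop \<Rightarrow> 'a bop" is "\<lambda>f x. - f x"
  by (simp add: bounded_linear_minus)

lift_definition zero_bop :: "'a bop" is "\<lambda>x. 0"
  by simp

lift_definition plus_bop :: "'a bop \<Rightarrow> 'a bop \<Rightarrow> 'a bop" is "\<lambda>f g x. f x + g x"
  by (simp add: bounded_linear_add scaleC_add_right)

lift_definition scaleC_bop :: "complex \<Rightarrow> 'a bop \<Rightarrow> 'a bop" is "\<lambda>c f x. c *\<^sub>C f x"
  by (auto intro: bounded_linear_compose[OF bounded_linear_scaleC] scaleC_left_commute)

definition scaleR_bop :: "real \<Rightarrow> 'a bop \<Rightarrow> 'a bop"
  where "scaleR_bop r T = complex_of_real r *\<^sub>C T"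

definition dist_bop :: "'a bop \<Rightarrow> 'a bop \<Rightarrow> real"
  where "dist_bop S T = norm (S - T)"

definition uniformity_bop :: "('a bop \<times> 'a bop) filter"
  where "uniformity_bop = (INF e\<in>{0 <..}. principal {(x, y). dist x y < e})"

definition open_bop :: "'a bop set \<Rightarrow> bool"
  where "open_bop U = (\<forall>x\<in>U. \<forall>\<^sub>F (x', y) in uniformity. x' = x \<longrightarrow> y \<in> U)"

definition sgn_bop :: "'a bop \<Rightarrow> 'a bop"
  where "sgn_bop T = inverse (norm T) *\<^sub>R T"

instance
proof
  fix c d :: complex and r s :: real and S T U :: "'a bop"
  show "S + T + U = S + (T + U)" "S + T = T + S" "0 + S = S" "- S + S = 0" "S - T = S + - T"
    by (transfer; simp add: algebra_simps)+
  show C: "c *\<^sub>C (S + T) = c *\<^sub>C S + c *\<^sub>C T" "(c + d) *\<^sub>C S = c *\<^sub>C S + d *\<^sub>C S"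
    "c *\<^sub>C d *\<^sub>C S = (c * d) *\<^sub>C S" for c d :: complex and S T :: "'a bop"
    by (transfer; simp add: scaleC_add_right scaleC_add_left scaleC_scaleC)+
  show norm_C: "norm (c *\<^sub>C S) = cmod c * norm S" for c
    by transfer (simp add: onorm_scaleC)
  show "r *\<^sub>R S = complex_of_real r *\<^sub>C S"
    by (rule scaleR_bop_def)
  show "r *\<^sub>R (S + T) = r *\<^sub>R S + r *\<^sub>R T" "(r + s) *\<^sub>R S = r *\<^sub>R S + s *\<^sub>R S"
    "r *\<^sub>R s *\<^sub>R S = (r * s) *\<^sub>R S"
    by (simp_all add: scaleR_bop_def C)
  show "1 *\<^sub>R S = S"
    unfolding scaleR_bop_def by transfer (simp add: scaleC_one)
  show "norm (r *\<^sub>R S) = \<bar>r\<bar> * norm S"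
    by (simp add: scaleR_bop_def norm_C)
  show "norm S = 0 \<longleftrightarrow> S = 0"
    by transfer (auto simp: onorm_eq_0)
  show "norm (S + T) \<le> norm S + norm T"
    by transfer (simp add: onorm_triangle)
qed (simp_all add: dist_bop_def sgn_bop_def uniformity_bop_def open_bop_def)

end

lemma bop_norm_apply: "norm (bop_apply T x) \<le> norm T * norm x"
  by transfer (simp add: onorm)

lemma norm_bop_bound:
  "0 \<le> b \<Longrightarrow> (\<And>x. norm (bop_apply T x) \<le> b * norm x) \<Longrightarrow> norm T \<le> b"
  by transfer (auto intro: onorm_bound)

instance bop :: (complex_banach) complex_banach
proof
  fix X :: "nat \<Rightarrow> 'a bop"
  assume X: "Cauchy X"
  define Y where "Y n = Blinfun (bop_apply (X n))" for n
  have Y: "blinfun_apply (Y n) = bop_apply (X n)" for n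
    by (simp add: Y_def bounded_linear_Blinfun_apply bounded_linear_bop_apply)
  have norm_Y: "norm (Y m - Y n) = norm (X m - X n)" for m n
  proof -
    have "blinfun_apply (Y m - Y n) = bop_apply (X m - X n)"
      by (rule ext) (simp add: blinfun.diff_left Y minus_bop.rep_eq)
    then show ?thesis by (simp add: norm_blinfun.rep_eq norm_bop.rep_eq)
  qed
  have "Cauchy Y"
    using X by (simp add: Cauchy_def dist_norm norm_Y)
  then obtain L where L: "Y \<longlonglongrightarrow> L"
    by (auto simp: Cauchy_convergent_iff convergent_def)
  have lim: "(\<lambda>n. bop_apply (X n) x) \<longlonglongrightarrow> blinfun_apply L x" for x
    using blinfun.tendsto[OF L tendsto_const[of x]] by (simp add: Y)
  have "blinfun_apply L (c *\<^sub>C x) = c *\<^sub>C blinfun_apply L x" for c x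
    using lim[of "c *\<^sub>C x"] bounded_linear.tendsto[OF bounded_linear_scaleC lim[of x], of c]
    by (simp add: bop_apply_scaleC LIMSEQ_unique)
  then have L': "bop_apply (Bop (blinfun_apply L)) = blinfun_apply L"
    by (simp add: Bop_inverse blinfun.bounded_linear_right)
  have norm_L: "norm (X n - Bop (blinfun_apply L)) = norm (Y n - L)" for n
  proof -
    have "blinfun_apply (Y n - L) = bop_apply (X n - Bop (blinfun_apply L))"
      by (rule ext) (simp add: blinfun.diff_left Y minus_bop.rep_eq L')
    then show ?thesis by (simp add: norm_blinfun.rep_eq norm_bop.rep_eq)
  qed
  have "X \<longlonglongrightarrow> Bop (blinfun_apply L)"
    using L by (simp add: LIMSEQ_iff norm_L)
  then show "convergent X" by (auto simp: convergent_def)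
qed

text \<open>The class \<open>real_normed_algebra_1\<close> is not available, as it excludes operators on the zero
  space.\<close>

instantiation bop :: (complex_normed_vector) "{real_normed_algebra, monoid_mult}"
begin

lift_definition times_bop :: "'a bop \<Rightarrow> 'a bop \<Rightarrow> 'a bop" is "\<lambda>f g x. f (g x)"
  by (simp add: bounded_linear_compose)

lift_definition one_bop :: "'a bop" is "\<lambda>x. x"
  by simp

instance
proof
  fix r :: real and S T U :: "'a bop"
  show "S * T * U = S * (T * U)" "1 * S = S" "S * 1 = S" "(S + T) * U = S * U + T * U"
    by (transfer; simp)+
  show "S * (T + U) = S * T + S * U"
    by transfer (simp add: linear_simps)
  show "r *\<^sub>R S * T = r *\<^sub>R (S * T)" "S * r *\<^sub>R T = r *\<^sub>R (S * T)"
    unfolding scaleR_bop_def by (transfer; simp)+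
  show "norm (S * T) \<le> norm S * norm T"
    by transfer (simp add: onorm_compose[unfolded comp_def])
qed

end

lemma scaleC_mult_right: "S * (c *\<^sub>C T) = c *\<^sub>C (S * T :: 'a :: complex_normed_vector bop)"
  by transfer simp

definition left_mult :: "'a :: complex_normed_vector bop \<Rightarrow> 'a bop bop"
  where "left_mult A = Bop (\<lambda>T. A * T)"

lemma left_mult_apply: "bop_apply (left_mult A) T = A * T"
  by (simp add: left_mult_def Bop_inverse bounded_linear_mult_right scaleC_mult_right)


section \<open>Dimensions\<close>

definition cdim :: "'a :: complex_normed_vector set \<Rightarrow> enat"
  where "cdim V = (if \<exists>B. finite B \<and> V \<subseteq> cspan B then enat (cdim_nat V) else \<infinity>)"

text \<open>The dimension of the quotient \<open>V / W\<close>, as the maximal number of linearly independent cosets.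
  The cosets \<open>b + W\<close> for \<open>b \<in> B\<close> are distinct and linearly independent in \<open>V / W\<close> iff no non-trivial
  linear combination of \<open>B\<close> lies in \<open>W\<close>.\<close>

definition quotient_cdim ::
    "'a :: complex_normed_vector set \<Rightarrow> 'a set \<Rightarrow> enat"
  where "quotient_cdim V W =
    (SUP B \<in> {B. finite B \<and> B \<subseteq> V \<and>
        (\<forall>c. (\<Sum>b\<in>B. c b *\<^sub>C b) \<in> W \<longrightarrow> (\<forall>b\<in>B. c b = 0))}. enat (card B))"


lemma quotient_cdim_zero: "quotient_cdim V {0} = cdim V"
proof -
  obtain B where B: "B \<subseteq> V" "\<not> cdependent B" "V \<subseteq> cspan B" "card B = cdim_nat V"
    using complex_vector.basis_exists[of V] by blast
  have Q: "quotient_cdim V {0} = (SUP C \<in> {C. finite C \<and> C \<subseteq> V \<and> \<not> cdependent C}. enat (card C))"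
    unfolding quotient_cdim_def
    by (rule arg_cong[of _ _ "\<lambda>S. SUP C \<in> S. enat (card C)"], intro Collect_cong conj_cong refl)
      (simp add: complex_vector.dependent_finite; blast)
  show ?thesis
  proof (cases "finite B")
    case True
    then have fin: "cdim V = enat (card B)"
      using B by (auto simp: cdim_def)
    have "card C \<le> card B" if "C \<subseteq> V" "\<not> cdependent C" for C
      using complex_vector.independent_span_bound[OF True that(2)] that(1) B(3) by blast
    then show ?thesis
      unfolding Q fin using True B by (intro antisym SUP_least SUP_upper2[of B]) auto
  next
    case False
    then have inf: "cdim V = \<infinity>"
      using complex_vector.independent_span_bound[OF _ B(2)] B(1) unfolding cdim_def by auto
    have "enat n \<le> quotient_cdim V {0}" for n
    proof -
      obtain C where C: "C \<subseteq> B" "finite C" "card C = n"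
        using infinite_arbitrarily_large[OF False] by blast
      with B complex_vector.independent_mono[OF B(2) C(1)] show ?thesis
        unfolding Q by (intro SUP_upper2[of C]) auto
    qed
    then show ?thesis
      unfolding inf by (metis Suc_ile_eq enat.exhaust less_irrefl)
  qed
qed


section \<open>Semi-Fredholm operators\<close>

text \<open>These notions are defined for the operator that \<open>T\<close> induces on a closed \<open>T\<close>-invariant subspace
  \<open>V\<close>; the operator \<open>T\<close> itself is the case \<open>V = UNIV\<close>.\<close>

definition null_space_on :: "'a :: complex_normed_vector set \<Rightarrow> 'a bop \<Rightarrow> 'a set"
  where "null_space_on V T = {x \<in> V. T x = 0}"

definition alpha_on :: "'a :: complex_normed_vector set \<Rightarrow> 'a bop \<Rightarrow> enat"
  where "alpha_on V T = cdim (null_space_on V T)"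

definition beta_on :: "'a :: complex_normed_vector set \<Rightarrow> 'a bop \<Rightarrow> enat"
  where "beta_on V T = quotient_cdim V (T ` V)"

definition upper_semi_fredholm_on :: "'a :: complex_normed_vector set \<Rightarrow> 'a bop \<Rightarrow> bool"
  where "upper_semi_fredholm_on V T \<longleftrightarrow> closed (T ` V) \<and> alpha_on V T < \<infinity>"

text \<open>Only meaningful for \<open>alpha_on V T < \<infinity>\<close>, where the value lies in the integers or is \<open>- \<infinity>\<close>.\<close>

definition index_on :: "'a :: complex_normed_vector set \<Rightarrow> 'a bop \<Rightarrow> ereal"
  where "index_on V T = ereal_of_enat (alpha_on V T) - ereal_of_enat (beta_on V T)"

abbreviation null_space :: "'a :: complex_normed_vector bop \<Rightarrow> 'a set"
  where "null_space \<equiv> null_space_on UNIV"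

abbreviation alpha :: "'a :: complex_normed_vector bop \<Rightarrow> enat"
  where "alpha \<equiv> alpha_on UNIV"

abbreviation beta :: "'a :: complex_normed_vector bop \<Rightarrow> enat"
  where "beta \<equiv> beta_on UNIV"

abbreviation upper_semi_fredholm :: "'a :: complex_normed_vector bop \<Rightarrow> bool"
  where "upper_semi_fredholm \<equiv> upper_semi_fredholm_on UNIV"

abbreviation fredholm_index :: "'a :: complex_normed_vector bop \<Rightarrow> ereal"
  where "fredholm_index \<equiv> index_on UNIV"

definition upper_semi_b_fredholm_at :: "'a :: complex_normed_vector bop \<Rightarrow> nat \<Rightarrow> bool"
  where "upper_semi_b_fredholm_at T n \<longleftrightarrow>
    closed (range (T ^ n)) \<and> upper_semi_fredholm_on (range (T ^ n)) T"

definition upper_semi_b_fredholm :: "'a :: complex_normed_vector bop \<Rightarrow> bool"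
  where "upper_semi_b_fredholm T \<longleftrightarrow> (\<exists>n. upper_semi_b_fredholm_at T n)"

text \<open>The index does not depend on the admissible \<open>n\<close>; the least one is taken.\<close>

definition b_fredholm_index :: "'a :: complex_normed_vector bop \<Rightarrow> ereal"
  where "b_fredholm_index T = index_on (range (T ^ (LEAST n. upper_semi_b_fredholm_at T n))) T"


section \<open>Parts of the spectrum\<close>

definition op_minus :: "'a :: complex_normed_vector bop \<Rightarrow> complex \<Rightarrow> 'a bop"
  where "op_minus T \<mu> = T - \<mu> *\<^sub>C 1"

definition bounded_below :: "'a :: complex_normed_vector bop \<Rightarrow> bool"
  where "bounded_below T \<longleftrightarrow> null_space T = {0} \<and> closed (range T)"

definition sigma_a :: "'a :: complex_normed_vector bop \<Rightarrow> complex set"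
  where "sigma_a T = {\<mu>. \<not> bounded_below (op_minus T \<mu>)}"

definition sigma_aw :: "'a :: complex_normed_vector bop \<Rightarrow> complex set"
  where "sigma_aw T = {\<mu> \<in> sigma_a T.
    \<not> upper_semi_fredholm (op_minus T \<mu>) \<or> 0 < fredholm_index (op_minus T \<mu>)}"

definition sigma_SBF :: "'a :: complex_normed_vector bop \<Rightarrow> complex set"
  where "sigma_SBF T = {\<mu>.
    \<not> upper_semi_b_fredholm (op_minus T \<mu>) \<or> 0 < b_fredholm_index (op_minus T \<mu>)}"

definition ascent :: "'a :: complex_normed_vector bop \<Rightarrow> enat"
  where "ascent T = (if \<exists>n. null_space (T ^ n) = null_space (T ^ Suc n)
    then enat (LEAST n. null_space (T ^ n) = null_space (T ^ Suc n)) else \<infinity>)"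

definition isolated_points :: "complex set \<Rightarrow> complex set"
  where "isolated_points K = {\<mu>. \<mu> isolated_in K}"

definition Pi_a :: "'a :: complex_normed_vector bop \<Rightarrow> complex set"
  where "Pi_a T = {\<mu> \<in> isolated_points (sigma_a T).
    \<exists>a. ascent (op_minus T \<mu>) = enat a \<and> closed (range (op_minus T \<mu> ^ (a + 1)))}"

definition Pi_a0 :: "'a :: complex_normed_vector bop \<Rightarrow> complex set"
  where "Pi_a0 T = {\<mu> \<in> Pi_a T. alpha (op_minus T \<mu>) < \<infinity>}"

definition E_a :: "'a :: complex_normed_vector bop \<Rightarrow> complex set"
  where "E_a T = {\<mu> \<in> isolated_points (sigma_a T). 0 < alpha (op_minus T \<mu>)}"

definition a_browder :: "'a :: complex_normed_vector bop \<Rightarrow> bool"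
  where "a_browder T \<longleftrightarrow> sigma_aw T = sigma_a T - Pi_a0 T"

definition generalized_a_weyl :: "'a :: complex_normed_vector bop \<Rightarrow> bool"
  where "generalized_a_weyl T \<longleftrightarrow> sigma_SBF T = sigma_a T - E_a T"

end

theory Submission
  imports Defs
begin

text \<open>
  Write \<open>L\<close> for \<open>left_mult A\<close>. The proof compares four facts about the sets in the statement.

  First, generalized a-Weyl's theorem for an operator is the conjunction of a-Browder's theorem and
  \<open>E_a = Pi_a\<close> (\<open>generalized_a_weyl_iff\<close>). Second, \<open>A\<close> and \<open>L\<close> have the same approximate point
  spectrum and the same \<open>E_a\<close> (\<open>sigma_a_left_mult\<close>, \<open>E_a_left_mult\<close>), while only
  \<open>Pi_a L \<subseteq> Pi_a A\<close> holds in general, because a closed range of \<open>A\<close> need not give a closed range of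
  \<open>L\<close> (\<open>Pi_a_left_mult_subset\<close>). Third, \<open>Pi_a A \<subseteq> E_a A\<close>. Fourth, \<open>L\<close> always satisfies a-Browder's
  theorem (\<open>a_browder_left_mult\<close>). Hence both sides of the equivalence say that \<open>A\<close> satisfies
  a-Browder's theorem and that \<open>Pi_a L = Pi_a A = E_a A\<close>.

  The transfer between \<open>A\<close> and \<open>L\<close> uses the operators of rank one, \<open>rank_one f y\<close>, whose
  product with \<open>A\<close> on the left is \<open>rank_one f (A y)\<close>. An infinite-dimensional space has
  arbitrarily large independent families of functionals (Hahn-Banach), so the null space of
  \<open>L - \<mu>\<close> on the range of a power of \<open>L - \<mu>\<close> is either zero or infinite-dimensional. Therefore,
  if \<open>L - \<mu>\<close> is upper semi B-Fredholm, its ascent is finite, which is the fourth fact.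

  The first fact rests on the equivalence of a-Browder's theorem with its generalized version,
  \<open>sigma_SBF = sigma_a - Pi_a\<close> (\<open>a_browder_iff\<close>). Let \<open>T = A - \<mu>\<close> be upper semi B-Fredholm. If its
  ascent is infinite, then a nonzero part of the null space lies in the intersection \<open>M\<close> of the
  ranges of the powers of \<open>T\<close>; the restriction of \<open>T\<close> to \<open>M\<close> is onto and not injective, and a power series
  produces eigenvectors of \<open>T\<close> for all small \<open>\<nu>\<close> (\<open>finite_ascent_or_eigenvalues\<close>). Thus \<open>\<mu>\<close>
  has a whole neighbourhood in \<open>sigma_a A\<close>. If in addition the index of \<open>T\<close> is not positive, a
  correction of finite rank makes \<open>T\<close> bounded below on the range of a power, and from this
  \<open>T - \<nu>\<close> is upper semi-Fredholm of non-positive index for small \<open>\<nu> \<noteq> 0\<close>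
  (\<open>nonpositive_index_stable\<close>), so that a-Browder's theorem makes these \<open>\<mu> + \<nu>\<close> isolated in
  \<open>sigma_a A\<close>: a contradiction. If the ascent is finite, \<open>T\<close> is left Drazin invertible, which
  describes the points of \<open>Pi_a\<close> (\<open>Pi_a_iff\<close>).

  Closedness of ranges is handled throughout by the open mapping theorem on closed subspaces,
  and index inequalities by one counting argument (\<open>alpha_le_beta_of_small_preimage\<close>).
\<close>

section \<open>Operators with closed range\<close>

text \<open>The successive approximation behind the open mapping theorem: each step solves \<open>f x = y\<close> up to
  half of the norm, and the error is again in \<open>Y\<close>, so the corrections form a geometrically convergent
  series.\<close>

lemma iterate_approximate_preimage:
  fixes f :: "'a::banach \<Rightarrow> 'b::banach"
  assumes f: "bounded_linear f" and V: "subspace V" "closed V"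
    and step: "\<And>y. y \<in> Y \<Longrightarrow>
      \<exists>x\<in>V. norm x \<le> C * norm y \<and> norm (y - f x) \<le> norm y / 2 \<and> y - f x \<in> Y"
    and y: "y \<in> Y"
  shows "\<exists>x\<in>V. f x = y \<and> norm x \<le> 2 * C * norm y"
proof -
  interpret f: bounded_linear f by fact
  obtain g where g: "\<And>y. y \<in> Y \<Longrightarrow>
      g y \<in> V \<and> norm (g y) \<le> C * norm y \<and> norm (y - f (g y)) \<le> norm y / 2 \<and> y - f (g y) \<in> Y"
    using step by metis
  define r where "r k = ((\<lambda>z. z - f (g z)) ^^ k) y" for k
  have r_Suc: "r (Suc k) = r k - f (g (r k))" and r_0: "r 0 = y" for k
    by (simp_all add: r_def)
  have r: "r k \<in> Y" "norm (r k) \<le> norm y * (1/2)^k" for k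
  proof (induction k)
    case (Suc k)
    { case 1 show ?case using Suc g r_Suc by simp }
    { case 2
      have "norm (r (Suc k)) \<le> norm (r k) / 2" using Suc g r_Suc by simp
      then show ?case using Suc(2) by simp }
  qed (simp_all add: r_0 y)
  have C: "0 \<le> C * norm y"
    using g[OF y] by (meson norm_ge_zero order_trans)
  have bound: "norm (g (r k)) \<le> C * norm y * (1/2)^k" for k
  proof (cases "y = 0")
    case True
    then show ?thesis using r(2)[of k] g[OF r(1)[of k]] by simp
  next
    case False
    then have "0 \<le> C" using C by (simp add: zero_le_mult_iff)
    then show ?thesis
      using g[OF r(1)[of k]] mult_left_mono[OF r(2)[of k], of C] by (simp add: mult.assoc)
  qed
  have geo: "(\<lambda>k. C * norm y * (1/2)^k) sums (C * norm y * 2)"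
    using sums_mult[OF geometric_sums[of "1/2::real"], of "C * norm y"] by simp
  have sumg: "summable (\<lambda>k. g (r k))"
    by (rule summable_comparison_test'[OF sums_summable[OF geo]]) (use bound in auto)
  define x where "x = (\<Sum>k. g (r k))"
  have "x \<in> V"
  proof -
    have lim: "(\<lambda>n. \<Sum>k<n. g (r k)) \<longlonglongrightarrow> x"
      unfolding x_def by (rule summable_LIMSEQ[OF sumg])
    have "(\<Sum>k<n. g (r k)) \<in> V" for n
      by (rule subspace_sum[OF V(1)]) (use g r in auto)
    then show ?thesis
      by (rule closed_sequentially[OF V(2) _ lim])
  qed
  moreover have "f x = y"
  proof -
    have "(\<lambda>k. f (g (r k))) sums f x"
      unfolding x_def by (rule f.sums[OF summable_sums[OF sumg]])
    moreover have "(\<lambda>k. f (g (r k))) sums (y - 0)"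
    proof -
      have "r \<longlonglongrightarrow> 0"
        by (rule Lim_null_comparison[of _ "\<lambda>k. norm y * (1/2)^k"])
          (use r in \<open>auto intro!: tendsto_mult_right_zero LIMSEQ_power_zero\<close>)
      then have "(\<lambda>k. r k - r (Suc k)) sums (r 0 - 0)"
        using telescope_sums'[of r 0] by simp
      then show ?thesis by (simp add: r_Suc r_0)
    qed
    ultimately show ?thesis using sums_unique2[of "\<lambda>k. f (g (r k))" "f x" "y - 0"] by simp
  qed
  moreover have "norm x \<le> 2 * C * norm y"
    unfolding x_def using norm_suminf_le[of "\<lambda>k. g (r k)" "\<lambda>k. C * norm y * (1/2)^k"] bound geo
    by (simp add: sums_iff mult_ac)
  ultimately show ?thesis by blast
qed

text \<open>The open mapping theorem for the restriction of \<open>f\<close> to \<open>V\<close>. By Baire's theorem in the complete space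
  \<open>f ` V\<close>, the closure of the image of some ball has interior points; differences of its elements
  approximate every vector of \<open>f ` V\<close> by the image of one with comparable norm.\<close>

lemma closed_image_imp_bounded_preimages:
  fixes f :: "'a::banach \<Rightarrow> 'b::banach"
  assumes f: "bounded_linear f" and V: "subspace V" "closed V" and cl: "closed (f ` V)"
  shows "\<exists>C>0. \<forall>y\<in>f ` V. \<exists>x\<in>V. f x = y \<and> norm x \<le> C * norm y"
proof -
  interpret f: bounded_linear f by fact
  define Y where "Y = f ` V"
  have Y: "subspace Y"
    unfolding Y_def by (rule linear_subspace_image[OF bounded_linear.linear[OF f] V(1)])
  define K where "K n = closure (f ` (V \<inter> cball 0 (real n)))" for n
  have KY: "K n \<subseteq> Y" for n
    unfolding K_def Y_def by (rule closure_minimal[OF _ cl]) auto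
  have UK: "(\<Union>n. K n) = Y"
  proof
    show "Y \<subseteq> (\<Union>n. K n)"
    proof
      fix y assume "y \<in> Y"
      then obtain x where x: "x \<in> V" "y = f x" by (auto simp: Y_def)
      obtain n where "norm x \<le> real n" using real_arch_simple by blast
      then have "y \<in> K n" unfolding K_def using x by (intro subsetD[OF closure_subset]) auto
      then show "y \<in> (\<Union>n. K n)" by blast
    qed
  qed (use KY in auto)
  have "\<exists>n. top_of_set Y interior_of K n \<noteq> {}"
  proof (rule ccontr)
    assume "\<not> ?thesis"
    have "top_of_set Y interior_of \<Union>(range K) = {}"
    proof (rule Baire_category_alt)
      show "completely_metrizable_space (top_of_set Y) \<or>
          locally_compact_space (top_of_set Y) \<and> regular_space (top_of_set Y)"
        using cl by (intro disjI1 completely_metrizable_space_closedin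
            completely_metrizable_space_euclidean) (simp add: Y_def)
      fix T assume "T \<in> range K"
      then obtain n where T: "T = K n" by blast
      have "closed (K n)" by (simp add: K_def)
      with KY have "closedin (top_of_set Y) (K n)" by (simp add: closed_subset)
      then show "closedin (top_of_set Y) T \<and> top_of_set Y interior_of T = {}"
        using T \<open>\<not> (\<exists>n. top_of_set Y interior_of K n \<noteq> {})\<close> by simp
    qed simp
    then have "Y = {}"
      using UK interior_of_topspace[of "top_of_set Y"] by simp
    then show False using subspace_0[OF Y] by blast
  qed
  then obtain n U y0 where U: "openin (top_of_set Y) U" "y0 \<in> U" "U \<subseteq> K n"
    unfolding interior_of_def by blast
  then obtain r where r: "r > 0" "ball y0 r \<inter> Y \<subseteq> U" and y0: "y0 \<in> Y"
    unfolding openin_contains_ball by blast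
  define C where "C = 4 * real n / r"
  have approx: "\<exists>x\<in>V. norm x \<le> C * norm y \<and> norm (y - f x) \<le> norm y / 2 \<and> y - f x \<in> Y"
    if y: "y \<in> Y" for y
  proof (cases "y = 0")
    case True
    then show ?thesis using subspace_0[OF V(1)] subspace_0[OF Y]
      by (intro bexI[of _ 0]) auto
  next
    case False
    \<comment> \<open>The multiple \<open>s *\<^sub>R y\<close> has norm \<open>r / 2\<close>, so \<open>y0 + s *\<^sub>R y\<close> stays in the ball.\<close>
    define s where "s = r / (2 * norm y)"
    have s: "s > 0" using r False by (simp add: s_def)
    have "s * norm y < r" using False r by (simp add: s_def)
    then have "y0 + s *\<^sub>R y \<in> ball y0 r" using s by (simp add: dist_norm)
    moreover have "y0 + s *\<^sub>R y \<in> Y"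
      using Y y y0 by (simp add: subspace_add subspace_scale)
    ultimately have 1: "y0 + s *\<^sub>R y \<in> K n" and 2: "y0 \<in> K n"
      using r U by auto
    have r8: "r/8 > 0" using r by simp
    obtain x1 where x1: "x1 \<in> V" "norm x1 \<le> n" "norm (f x1 - (y0 + s *\<^sub>R y)) < r/8"
      using 1[unfolded K_def closure_approachable, rule_format, OF r8] by (auto simp: dist_norm)
    obtain x2 where x2: "x2 \<in> V" "norm x2 \<le> n" "norm (f x2 - y0) < r/8"
      using 2[unfolded K_def closure_approachable, rule_format, OF r8] by (auto simp: dist_norm)
    define x where "x = (1/s) *\<^sub>R (x1 - x2)"
    have xV: "x \<in> V" using V x1 x2 by (simp add: x_def subspace_diff subspace_scale)
    have "norm (x1 - x2) \<le> 2 * real n"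
      using x1 x2 norm_triangle_ineq4[of x1 x2] by linarith
    then have "norm x \<le> 2 * real n / s"
      using s by (simp add: x_def divide_right_mono)
    then have nx: "norm x \<le> C * norm y"
      using False r by (simp add: s_def C_def)
    have "norm (f (x1 - x2) - s *\<^sub>R y) \<le> r/8 + r/8"
    proof -
      have "f (x1 - x2) - s *\<^sub>R y = (f x1 - (y0 + s *\<^sub>R y)) - (f x2 - y0)"
        by (simp add: f.diff)
      also have "norm \<dots> \<le> norm (f x1 - (y0 + s *\<^sub>R y)) + norm (f x2 - y0)"
        by (rule norm_triangle_ineq4)
      also have "\<dots> \<le> r/8 + r/8"
        using x1(3) x2(3) by (intro add_mono less_imp_le)
      finally show ?thesis .
    qed
    moreover have "s *\<^sub>R f x = f (x1 - x2)"
      using s by (simp add: x_def f.scaleR)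
    then have "f (x1 - x2) - s *\<^sub>R y = - (s *\<^sub>R (y - f x))"
      by (simp add: scaleR_right_diff_distrib)
    ultimately have "s * norm (y - f x) \<le> r/4" using s by simp
    then have "norm (y - f x) \<le> norm y / 2"
      using s r False by (simp add: s_def field_simps)
    moreover have "y - f x \<in> Y" using Y y xV by (simp add: subspace_diff Y_def)
    ultimately show ?thesis using xV nx by blast
  qed
  have "C \<ge> 0" using r by (simp add: C_def)
  have "\<exists>x\<in>V. f x = y \<and> norm x \<le> (2 * C + 1) * norm y" if y: "y \<in> f ` V" for y
  proof -
    obtain x where x: "x \<in> V" "f x = y" "norm x \<le> 2 * C * norm y"
      using iterate_approximate_preimage[OF f V approx y[folded Y_def]] by blast
    then have "norm x \<le> (2 * C + 1) * norm y" by (simp add: distrib_right add_increasing2)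
    then show ?thesis using x by blast
  qed
  then show ?thesis using \<open>C \<ge> 0\<close> by (intro exI[of _ "2 * C + 1"]) auto
qed

lemma subspace_closure:
  fixes S :: "'a::real_normed_vector set"
  assumes "subspace S" shows "subspace (closure S)"
proof (rule subspaceI)
  show "0 \<in> closure S" using subspace_0[OF assms] closure_subset by blast
next
  fix x y assume "x \<in> closure S" "y \<in> closure S"
  then obtain a b where "\<forall>n. a n \<in> S" "a \<longlonglongrightarrow> x" "\<forall>n. b n \<in> S" "b \<longlonglongrightarrow> y"
    unfolding closure_sequential by blast
  then show "x + y \<in> closure S"
    unfolding closure_sequential
    by (intro exI[of _ "\<lambda>n. a n + b n"]) (auto intro: tendsto_add subspace_add[OF assms])
next
  fix c x assume "x \<in> closure S"
  then obtain a where "\<forall>n. a n \<in> S" "a \<longlonglongrightarrow> x"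
    unfolding closure_sequential by blast
  then show "c *\<^sub>R x \<in> closure S"
    unfolding closure_sequential
    by (intro exI[of _ "\<lambda>n. c *\<^sub>R a n"]) (auto intro: tendsto_scaleR subspace_scale[OF assms])
qed

text \<open>The same successive approximation, started from a point \<open>y\<close> of the closure: a nearby
  value \<open>f x\<close> has a preimage of norm comparable to that of \<open>y\<close>.\<close>

lemma bounded_preimages_imp_closed_image:
  fixes f :: "'a::banach \<Rightarrow> 'b::banach"
  assumes f: "bounded_linear f" and V: "subspace V" "closed V"
    and C: "C > 0" "\<And>x. x \<in> V \<Longrightarrow> \<exists>x'\<in>V. f x' = f x \<and> norm x' \<le> C * norm (f x)"
  shows "closed (f ` V)"
proof -
  define Y where "Y = closure (f ` V)"
  have Y: "subspace Y"
    unfolding Y_def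
    by (rule subspace_closure[OF linear_subspace_image[OF bounded_linear.linear[OF f] V(1)]])
  have fY: "f x \<in> Y" if "x \<in> V" for x
    unfolding Y_def by (rule subsetD[OF closure_subset]) (use that in auto)
  have step: "\<exists>x\<in>V. norm x \<le> (2 * C) * norm y \<and> norm (y - f x) \<le> norm y / 2 \<and> y - f x \<in> Y"
    if y: "y \<in> Y" for y
  proof (cases "y = 0")
    case True
    then show ?thesis using subspace_0[OF V(1)] subspace_0[OF Y] linear_0[OF bounded_linear.linear[OF f]]
      by (intro bexI[of _ 0]) auto
  next
    case False
    then obtain x where x: "x \<in> V" "dist (f x) y < norm y / 2"
      using y[unfolded Y_def closure_approachable, rule_format, of "norm y / 2"] by auto
    obtain x' where x': "x' \<in> V" "f x' = f x" "norm x' \<le> C * norm (f x)" using C(2)[OF x(1)] by blast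
    have d: "norm (y - f x) \<le> norm y / 2" using x(2) by (simp add: dist_norm norm_minus_commute)
    then have "norm (f x) \<le> 2 * norm y"
      using norm_triangle_ineq2[of "f x" y] norm_ge_zero[of y]
      by (simp add: norm_minus_commute del: norm_ge_zero)
    then have "norm x' \<le> (2 * C) * norm y"
      using x'(3) mult_left_mono[OF _ less_imp_le[OF C(1)], of "norm (f x)" "2 * norm y"] by simp
    then show ?thesis using x' d y fY[OF x(1)] Y by (intro bexI[of _ x']) (auto simp: subspace_diff)
  qed
  have "Y \<subseteq> f ` V"
    using iterate_approximate_preimage[OF f V step] by blast
  then show ?thesis
    unfolding Y_def closure_subset_eq .
qed

text \<open>An operator range with a closed complement in a closed space is closed. By the open mapping theorem
  for \<open>(v, w) \<mapsto> f v + w\<close>, an element \<open>f x\<close> is \<open>f v + w\<close> with \<open>v\<close> of controlled norm, and then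
  \<open>w = 0\<close>, because \<open>w\<close> lies in both summands.\<close>

lemma closed_image_of_closed_direct_summand:
  fixes f :: "'a::banach \<Rightarrow> 'b::banach"
  assumes f: "bounded_linear f" and V: "subspace V" "closed V" and F: "subspace F" "closed F"
    and triv: "f ` V \<inter> F \<subseteq> {0}" and cl: "closed {f v + w | v w. v \<in> V \<and> w \<in> F}"
  shows "closed (f ` V)"
proof -
  interpret f: bounded_linear f by fact
  define g where "g = (\<lambda>p. f (fst p) + snd p)"
  have g: "bounded_linear g"
    unfolding g_def by (intro bounded_linear_add bounded_linear_compose[OF f] bounded_linear_fst bounded_linear_snd)
  have "g ` (V \<times> F) = {f v + w | v w. v \<in> V \<and> w \<in> F}"
    by (auto simp: g_def image_def)
  with cl have "closed (g ` (V \<times> F))" by simp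
  then obtain C where C: "C > 0" "\<forall>y\<in>g ` (V \<times> F). \<exists>x\<in>V \<times> F. g x = y \<and> norm x \<le> C * norm y"
    using closed_image_imp_bounded_preimages[OF g subspace_Times[OF V(1) F(1)] closed_Times[OF V(2) F(2)]]
    by blast
  show ?thesis
  proof (rule bounded_preimages_imp_closed_image[OF f V C(1)])
    fix x assume x: "x \<in> V"
    then have "f x \<in> g ` (V \<times> F)"
      using subspace_0[OF F(1)] by (intro image_eqI[of _ _ "(x, 0)"]) (auto simp: g_def)
    then obtain v w where vw: "v \<in> V" "w \<in> F" "f v + w = f x" "norm (v, w) \<le> C * norm (f x)"
      using bspec[OF C(2), of "f x"] by (auto simp: g_def)
    have w: "w = f (x - v)" using vw by (simp add: f.diff algebra_simps)
    have "x - v \<in> V" using vw x V(1) by (simp add: subspace_diff)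
    then have "w = 0" using triv vw(2) w by blast
    then show "\<exists>x'\<in>V. f x' = f x \<and> norm x' \<le> C * norm (f x)"
      using vw by auto
  qed
qed

text \<open>If \<open>f u\<close> is close to \<open>f v\<close>, a small correction of \<open>v\<close> has the same value as \<open>u\<close>, so \<open>v\<close> is close to
  \<open>U + ker f\<close>. This replaces a passage to the quotient by the kernel.\<close>

lemma closed_image_of_subspace:
  fixes f :: "'a::banach \<Rightarrow> 'b::banach"
  assumes f: "bounded_linear f" and V: "subspace V" "closed V" and cl: "closed (f ` V)"
    and U: "U \<subseteq> V" and sum: "closed {u + z | u z. u \<in> U \<and> z \<in> V \<and> f z = 0}"
  shows "closed (f ` U)"
proof -
  interpret f: bounded_linear f by fact
  obtain C where C: "C > 0" "\<forall>y\<in>f ` V. \<exists>x\<in>V. f x = y \<and> norm x \<le> C * norm y"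
    using closed_image_imp_bounded_preimages[OF f V cl] by blast
  have "closure (f ` U) \<subseteq> f ` U"
  proof
    fix y assume y: "y \<in> closure (f ` U)"
    moreover have "closure (f ` U) \<subseteq> f ` V" using U by (intro closure_minimal[OF _ cl]) auto
    ultimately obtain v where v: "v \<in> V" "y = f v" by blast
    have "v \<in> closure {u + z | u z. u \<in> U \<and> z \<in> V \<and> f z = 0}"
      unfolding closure_approachable
    proof (intro allI impI)
      fix e :: real assume e: "e > 0"
      obtain u where u: "u \<in> U" "norm (f u - y) < e / C"
        using y[unfolded closure_approachable, rule_format, of "e / C"] e C(1)
        by (auto simp: dist_norm)
      have "f u - y \<in> f ` V" using u U v V(1) by (auto simp: f.diff[symmetric] subspace_diff)
      then obtain v' where v': "v' \<in> V" "f v' = f u - y" "norm v' \<le> C * norm (f u - y)"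
        using C(2) by blast
      have "norm v' < e"
        using v'(3) u(2) C(1) by (simp add: field_simps)
      moreover have "v + v' = u + (v + v' - u)" "v + v' - u \<in> V" "f (v + v' - u) = 0"
        using v v' u U V(1) by (auto simp: f.add f.diff subspace_add subspace_diff)
      ultimately show "\<exists>y\<in>{u + z | u z. u \<in> U \<and> z \<in> V \<and> f z = 0}. dist y v < e"
        using u(1) by (intro bexI[of _ "v + v'"] CollectI exI conjI) (auto simp: dist_norm)
    qed
    then obtain u z where "u \<in> U" "v = u + z" "f z = 0"
      using sum by auto
    then show "y \<in> f ` U" using v by (auto simp: f.add)
  qed
  then show ?thesis using closure_subset_eq by blast
qed

section \<open>The Hahn-Banach theorem\<close>

definition sublinear :: "('a::real_vector \<Rightarrow> real) \<Rightarrow> bool"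
  where "sublinear q \<longleftrightarrow> (\<forall>x y. q (x + y) \<le> q x + q y) \<and> (\<forall>t x. 0 \<le> t \<longrightarrow> q (t *\<^sub>R x) = t * q x)"

lemma sublinearD:
  assumes "sublinear q"
  shows "q (x + y) \<le> q x + q y" "0 \<le> t \<Longrightarrow> q (t *\<^sub>R x) = t * q x" "q 0 = 0" "- q (- x) \<le> q x"
proof -
  show "q (x + y) \<le> q x + q y" "0 \<le> t \<Longrightarrow> q (t *\<^sub>R x) = t * q x" for x y t
    using assms by (auto simp: sublinear_def)
  note * = this
  show "q 0 = 0" using *(2)[of 0 0] by simp
  with *(1)[of x "- x"] show "- q (- x) \<le> q x" by simp
qed

text \<open>The function \<open>\<lambda>x. INF t\<ge>0. q (x + t y) - t q y\<close>. Applied to a minimal sublinear functional it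
  shows additivity; applied at the start, it forces the value in one direction.\<close>

lemma sublinear_lower_in_direction:
  fixes q :: "'a::real_vector \<Rightarrow> real"
  assumes q: "sublinear q"
  shows "\<exists>q'. sublinear q' \<and> (\<forall>x. q' x \<le> q x) \<and> (\<forall>x. q' x \<le> q (x + y) - q y)"
proof -
  define S where "S x = (\<lambda>t. q (x + t *\<^sub>R y) - t * q y) ` {0..}" for x
  define q' where "q' x = Inf (S x)" for x
  have bdd: "bdd_below (S x)" for x
  proof (rule bdd_belowI[of _ "- q (- x)"])
    fix z assume "z \<in> S x"
    then obtain t where t: "0 \<le> t" "z = q (x + t *\<^sub>R y) - t * q y" by (auto simp: S_def)
    have "q (t *\<^sub>R y) \<le> q (x + t *\<^sub>R y) + q (- x)"
      using sublinearD(1)[OF q, of "x + t *\<^sub>R y" "- x"] by simp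
    then show "- q (- x) \<le> z" using t sublinearD(2)[OF q, of t y] by simp
  qed
  have le: "q' x \<le> q (x + t *\<^sub>R y) - t * q y" if "0 \<le> t" for x t
    unfolding q'_def by (rule cInf_lower[OF _ bdd]) (use that in \<open>auto simp: S_def\<close>)
  have ge: "b \<le> q' x" if "\<And>t. 0 \<le> t \<Longrightarrow> b \<le> q (x + t *\<^sub>R y) - t * q y" for b x
    unfolding q'_def by (rule cInf_greatest) (use that in \<open>auto simp: S_def\<close>)
  have add: "q' (u + v) \<le> q' u + q' v" for u v
  proof -
    have "q' (u + v) - q' v \<le> q' u"
    proof (rule ge)
      fix s :: real assume s: "0 \<le> s"
      have "q' (u + v) - (q (u + s *\<^sub>R y) - s * q y) \<le> q' v"
      proof (rule ge)
        fix t :: real assume t: "0 \<le> t"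
        have "q' (u + v) \<le> q ((u + v) + (s + t) *\<^sub>R y) - (s + t) * q y"
          using s t by (intro le) simp
        also have "q ((u + v) + (s + t) *\<^sub>R y) \<le> q (u + s *\<^sub>R y) + q (v + t *\<^sub>R y)"
          using sublinearD(1)[OF q, of "u + s *\<^sub>R y" "v + t *\<^sub>R y"] by (simp add: algebra_simps)
        finally show "q' (u + v) - (q (u + s *\<^sub>R y) - s * q y) \<le> q (v + t *\<^sub>R y) - t * q y"
          by (simp add: algebra_simps)
      qed
      then show "q' (u + v) - q' v \<le> q (u + s *\<^sub>R y) - s * q y" by simp
    qed
    then show ?thesis by simp
  qed
  have scale_le: "q' (c *\<^sub>R x) \<le> c * q' x" if c: "c > 0" for c x
  proof -
    have "q' (c *\<^sub>R x) / c \<le> q' x"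
    proof (rule ge)
      fix t :: real assume t: "0 \<le> t"
      have "q' (c *\<^sub>R x) \<le> q (c *\<^sub>R x + (c * t) *\<^sub>R y) - (c * t) * q y"
        using c t by (intro le) simp
      also have "q (c *\<^sub>R x + (c * t) *\<^sub>R y) = c * q (x + t *\<^sub>R y)"
        using sublinearD(2)[OF q, of c "x + t *\<^sub>R y"] c by (simp add: algebra_simps)
      finally show "q' (c *\<^sub>R x) / c \<le> q (x + t *\<^sub>R y) - t * q y"
        using c by (simp add: field_simps)
    qed
    then show ?thesis using c by (simp add: field_simps)
  qed
  have scale: "q' (c *\<^sub>R x) = c * q' x" if c: "c > 0" for c x
  proof (rule antisym[OF scale_le[OF c]])
    have "q' ((1/c) *\<^sub>R c *\<^sub>R x) \<le> (1/c) * q' (c *\<^sub>R x)" using c by (intro scale_le) simp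
    then show "c * q' x \<le> q' (c *\<^sub>R x)" using c by (simp add: field_simps)
  qed
  have "q' 0 = 0"
  proof -
    have "q' 0 = 2 * q' 0" using scale[of 2 0] by simp
    then show ?thesis by simp
  qed
  then have "sublinear q'"
    unfolding sublinear_def using add scale by (auto simp: le_less)
  then show ?thesis using le[of 0] le[of 1] by auto
qed

text \<open>Zorn's lemma for the reversed pointwise order; the values along a chain are bounded below by \<open>- p (- x)\<close>.\<close>

lemma minimal_sublinear_exists:
  fixes p :: "'a::real_vector \<Rightarrow> real"
  assumes p: "sublinear p"
  shows "\<exists>g. sublinear g \<and> (\<forall>x. g x \<le> p x) \<and> (\<forall>q. sublinear q \<and> (\<forall>x. q x \<le> g x) \<longrightarrow> q = g)"
proof -
  define A where "A = {q. sublinear q \<and> (\<forall>x. q x \<le> p x)}"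
  define r where "r = {(q1, q2). q1 \<in> A \<and> q2 \<in> A \<and> (\<forall>x. q2 x \<le> q1 x)}"
  have field: "Field r = A" by (auto simp: Field_def r_def)
  have po: "Partial_order r"
    unfolding partial_order_on_def preorder_on_def refl_on_def field trans_def antisym_def
    by (auto simp: r_def intro: order_trans intro!: ext antisym)
  have "\<exists>m\<in>Field r. \<forall>a\<in>Field r. (m, a) \<in> r \<longrightarrow> a = m"
  proof (rule Zorns_po_lemma[OF po])
    fix C assume C: "C \<in> Chains r"
    then have CA: "C \<subseteq> A" and tot: "\<And>a b. a \<in> C \<Longrightarrow> b \<in> C \<Longrightarrow> (\<forall>x. a x \<le> b x) \<or> (\<forall>x. b x \<le> a x)"
      by (auto simp: Chains_def r_def)
    show "\<exists>u\<in>Field r. \<forall>a\<in>C. (a, u) \<in> r"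
    proof (cases "C = {}")
      case True
      then show ?thesis using p by (auto simp: field A_def)
    next
      case False
      define u where "u x = (INF q\<in>C. q x)" for x
      have bdd: "bdd_below ((\<lambda>q. q x) ` C)" for x
      proof (rule bdd_belowI2[of _ "- p (- x)"])
        fix q assume "q \<in> C"
        then have q: "sublinear q" "\<forall>x. q x \<le> p x" using CA by (auto simp: A_def)
        then show "- p (- x) \<le> q x" using sublinearD(4)[OF q(1), of x] q(2)[rule_format, of "- x"] by linarith
      qed
      have le: "u x \<le> q x" if "q \<in> C" for q x
        unfolding u_def by (rule cINF_lower[OF bdd that])
      have ge: "b \<le> u x" if "\<And>q. q \<in> C \<Longrightarrow> b \<le> q x" for b x
        unfolding u_def by (rule cINF_greatest[OF False that])
      have sub: "sublinear q" if "q \<in> C" for q using CA that by (auto simp: A_def)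
      have "u (x + y) \<le> u x + u y" for x y
      proof -
        have "u (x + y) - u y \<le> u x"
        proof (rule ge)
          fix q assume q: "q \<in> C"
          have "u (x + y) - q x \<le> u y"
          proof (rule ge)
            fix q' assume q': "q' \<in> C"
            consider "\<forall>x. q x \<le> q' x" | "\<forall>x. q' x \<le> q x" using tot[OF q q'] by blast
            then show "u (x + y) - q x \<le> q' y"
            proof cases
              case 1
              then show ?thesis
                using le[OF q, of "x + y"] sublinearD(1)[OF sub[OF q], of x y] spec[of _ y] by (smt (verit))
            next
              case 2
              then show ?thesis
                using le[OF q', of "x + y"] sublinearD(1)[OF sub[OF q'], of x y] by (smt (verit))
            qed
          qed
          then show "u (x + y) - u y \<le> q x" by simp
        qed
        then show ?thesis by simp
      qed
      moreover have "u (t *\<^sub>R x) = t * u x" if t: "0 \<le> t" for t x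
      proof (cases "t = 0")
        case True
        have "u 0 = 0"
          using INF_cong[of C C "\<lambda>q. q 0" "\<lambda>_. 0::real"] sublinearD(3)[OF sub] \<open>C \<noteq> {}\<close>
          by (simp add: u_def)
        then show ?thesis using True by simp
      next
        case False
        with t have t: "t > 0" by simp
        have "u (t *\<^sub>R x) / t \<le> u x"
        proof (rule ge)
          fix q assume q: "q \<in> C"
          show "u (t *\<^sub>R x) / t \<le> q x"
            using le[OF q, of "t *\<^sub>R x"] sublinearD(2)[OF sub[OF q], of t x] t by (simp add: field_simps)
        qed
        moreover have "t * u x \<le> u (t *\<^sub>R x)"
        proof (rule ge)
          fix q assume q: "q \<in> C"
          show "t * u x \<le> q (t *\<^sub>R x)"
            using le[OF q, of x] sublinearD(2)[OF sub[OF q], of t x] t by simp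
        qed
        ultimately show ?thesis using t by (simp add: field_simps)
      qed
      ultimately have "sublinear u" by (simp add: sublinear_def)
      moreover have "u x \<le> p x" for x
      proof -
        obtain q where q: "q \<in> C" using False by blast
        then have "q x \<le> p x" using CA by (auto simp: A_def)
        then show ?thesis using le[OF q, of x] by simp
      qed
      ultimately have "u \<in> A" by (simp add: A_def)
      moreover have "(q, u) \<in> r" if "q \<in> C" for q
        using that CA le[OF that] \<open>u \<in> A\<close> by (auto simp: r_def)
      ultimately show ?thesis by (auto simp: field)
    qed
  qed
  then obtain g where g: "g \<in> A" "\<And>q. q \<in> A \<Longrightarrow> (g, q) \<in> r \<Longrightarrow> q = g"
    unfolding field by blast
  have "q = g" if q: "sublinear q" "\<forall>x. q x \<le> g x" for q
  proof -
    have "q \<in> A" using q g(1) unfolding A_def by (auto intro: order_trans)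
    moreover have "(g, q) \<in> r" using calculation g(1) q(2) by (simp add: r_def)
    ultimately show ?thesis by (rule g(2))
  qed
  then show ?thesis using g(1) by (intro exI[of _ g]) (auto simp: A_def)
qed

text \<open>A minimal sublinear functional is linear, since lowering it in any direction leaves it unchanged.
  Choosing it below the lowering of \<open>p\<close> in direction \<open>e\<close> gives \<open>g (- e) \<le> - p e\<close>, hence \<open>g e = p e\<close>.\<close>

lemma hahn_banach_sublinear:
  fixes p :: "'a::real_vector \<Rightarrow> real"
  assumes p: "sublinear p"
  shows "\<exists>g. linear g \<and> (\<forall>x. g x \<le> p x) \<and> g e = p e"
proof -
  obtain p' where p': "sublinear p'" "\<And>x. p' x \<le> p x" "\<And>x. p' x \<le> p (x + e) - p e"
    using sublinear_lower_in_direction[OF p, of e] by blast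
  obtain g where g: "sublinear g" "\<And>x. g x \<le> p' x"
    and min: "\<And>q. sublinear q \<Longrightarrow> (\<And>x. q x \<le> g x) \<Longrightarrow> q = g"
    using minimal_sublinear_exists[OF p'(1)] by blast
  have add: "g (x + y) = g x + g y" for x y
  proof (rule antisym[OF sublinearD(1)[OF g(1)]])
    obtain q where q: "sublinear q" "\<And>x. q x \<le> g x" "\<And>x. q x \<le> g (x + y) - g y"
      using sublinear_lower_in_direction[OF g(1), of y] by blast
    have "q = g" by (rule min[OF q(1,2)])
    then show "g x + g y \<le> g (x + y)" using q(3)[of x] by simp
  qed
  have neg: "g (- x) = - g x" for x
    using add[of x "- x"] sublinearD(3)[OF g(1)] by simp
  have "linear g"
  proof (rule linearI)
    show "g (c *\<^sub>R x) = c *\<^sub>R g x" for c x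
    proof (cases "0 \<le> c")
      case True
      then show ?thesis using sublinearD(2)[OF g(1)] by simp
    next
      case False
      then have "g ((- c) *\<^sub>R x) = (- c) * g x" by (intro sublinearD(2)[OF g(1)]) simp
      then show ?thesis using neg[of "c *\<^sub>R x"] by simp
    qed
  qed (rule add)
  moreover have "g x \<le> p x" for x using g(2) p'(2) order_trans by blast
  moreover have "g e = p e"
  proof (rule antisym)
    show "g e \<le> p e" by fact
    have "- g e \<le> p' (- e)" using neg g(2)[of "- e"] by simp
    also have "\<dots> \<le> - p e" using p'(3)[of "- e"] sublinearD(3)[OF p] by simp
    finally show "p e \<le> g e" by simp
  qed
  ultimately show ?thesis by blast
qed

section \<open>Finite-dimensional extensions of closed complex subspaces\<close>

lemma csubspace_imp_subspace: "csubspace V \<Longrightarrow> subspace V"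
  by (rule subspaceI)
    (auto simp: scaleR_eq_scaleC complex_vector.subspace_0 complex_vector.subspace_add
      complex_vector.subspace_scale)

lemma bounded_linear_scaleC_left: "bounded_linear (\<lambda>c. c *\<^sub>C (v :: 'a::complex_normed_vector))"
  by (rule bounded_linear_intro[of _ "norm v"])
    (simp_all add: scaleC_add_left scaleR_eq_scaleC scaleC_scaleC norm_scaleC scaleR_conv_of_real)

lemma norm_add_scaleC_ge_infdist:
  assumes C: "csubspace C" and x: "x \<in> C"
  shows "cmod c * infdist v C \<le> norm (x + c *\<^sub>C v)"
proof (cases "c = 0")
  case False
  have "infdist v C \<le> dist v (- (inverse c *\<^sub>C x))"
    using C x by (intro infdist_le complex_vector.subspace_neg complex_vector.subspace_scale)
  also have "\<dots> = norm (inverse c *\<^sub>C (x + c *\<^sub>C v))"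
    using False by (simp add: dist_norm scaleC_add_right scaleC_scaleC scaleC_one add.commute)
  also have "\<dots> = norm (x + c *\<^sub>C v) / cmod c"
    by (simp add: norm_scaleC norm_inverse divide_inverse)
  finally show ?thesis using False by (simp add: field_simps)
qed simp

text \<open>The coefficient of \<open>v\<close> is controlled by the norm, since \<open>v\<close> has positive distance to the closed
  span of \<open>S\<close> unless it belongs to it. So the coefficients of a convergent sequence converge.\<close>

lemma closed_cspan_insert:
  fixes v :: "'a::complex_banach"
  assumes "closed (cspan S)"
  shows "closed (cspan (insert v S))"
proof (cases "v \<in> cspan S")
  case True
  then show ?thesis using assms by (simp add: complex_vector.span_redundant)
next
  case False
  define C where "C = cspan S"
  have C: "csubspace C" "closed C" "C \<noteq> {}"
    using assms complex_vector.span_zero[of S] by (auto simp: C_def)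
  have ins: "y \<in> cspan (insert v S) \<longleftrightarrow> (\<exists>c. y - c *\<^sub>C v \<in> C)" for y
    by (simp add: complex_vector.span_insert C_def)
  define d where "d = infdist v C"
  have d: "d > 0"
    using False C in_closed_iff_infdist_zero[OF C(2,3), of v] infdist_nonneg[of v C]
    unfolding d_def C_def by linarith
  show ?thesis
    unfolding closed_sequential_limits
  proof (intro allI impI, elim conjE)
    fix y l assume y: "\<forall>n. y n \<in> cspan (insert v S)" and l: "y \<longlonglongrightarrow> l"
    have "\<forall>n. \<exists>c. y n - c *\<^sub>C v \<in> C" using y unfolding ins .
    then obtain c where c: "\<And>n. y n - c n *\<^sub>C v \<in> C" by metis
    have le: "d * cmod (c m - c n) \<le> norm (y m - y n)" for m n
    proof -
      have "(y m - c m *\<^sub>C v) - (y n - c n *\<^sub>C v) \<in> C"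
        using c C(1) by (simp add: complex_vector.subspace_diff)
      from norm_add_scaleC_ge_infdist[OF C(1) this, of "c m - c n" v]
      show ?thesis by (simp add: d_def mult.commute complex_vector.scale_left_diff_distrib)
    qed
    have "Cauchy c"
    proof (rule metric_CauchyI)
      fix e :: real assume "e > 0"
      then have "d * e > 0" using d by simp
      then obtain M where M: "\<forall>m\<ge>M. \<forall>n\<ge>M. norm (y m - y n) < d * e"
        using LIMSEQ_imp_Cauchy[OF l] unfolding Cauchy_def dist_norm by blast
      have "dist (c m) (c n) < e" if "m \<ge> M" "n \<ge> M" for m n
      proof -
        have "d * cmod (c m - c n) < d * e" using M that le[of m n] by (meson le_less_trans)
        then show ?thesis using d by (simp add: dist_norm)
      qed
      then show "\<exists>M. \<forall>m\<ge>M. \<forall>n\<ge>M. dist (c m) (c n) < e" by blast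
    qed
    then obtain c0 where c0: "c \<longlonglongrightarrow> c0" by (auto simp: Cauchy_convergent_iff convergent_def)
    have "(\<lambda>n. y n - c n *\<^sub>C v) \<longlonglongrightarrow> l - c0 *\<^sub>C v"
      by (rule tendsto_diff[OF l bounded_linear.tendsto[OF bounded_linear_scaleC_left c0]])
    then have "l - c0 *\<^sub>C v \<in> C"
      by (rule closed_sequentially[OF C(2) c])
    then show "l \<in> cspan (insert v S)" unfolding ins by blast
  qed
qed

lemma closed_cspan_Un_finite:
  fixes S :: "'a::complex_banach set"
  assumes "finite B" "closed (cspan S)"
  shows "closed (cspan (S \<union> B))"
  using assms by induction (auto intro: closed_cspan_insert)

lemma closed_cspan_finite:
  fixes B :: "'a::complex_banach set"
  assumes "finite B" shows "closed (cspan B)"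
  using closed_cspan_Un_finite[OF assms, of "{}"] by simp

text \<open>The span of \<open>B\<close> can be larger than \<open>N\<close>, so the vectors added to \<open>C\<close> are a basis of \<open>N\<close>, not \<open>B\<close>.\<close>

lemma closed_csubspace_plus_finite:
  fixes C :: "'a::complex_banach set"
  assumes C: "csubspace C" "closed C" and N: "csubspace N" "N \<subseteq> cspan B" "finite B"
  shows "closed {x + y | x y. x \<in> C \<and> y \<in> N}"
proof -
  obtain E where E: "E \<subseteq> N" "\<not> cdependent E" "N \<subseteq> cspan E" "card E = cdim_nat N"
    using complex_vector.basis_exists[of N] by blast
  have "finite E"
    using complex_vector.independent_span_bound[OF N(3) E(2) subset_trans[OF E(1) N(2)]] by simp
  have spC: "cspan C = C" using C(1) by (simp only: complex_vector.span_eq_iff)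
  have "closed (cspan C)" using C(2) by (simp only: spC)
  with \<open>finite E\<close> have "closed (cspan (C \<union> E))" by (rule closed_cspan_Un_finite)
  moreover have "cspan E = N"
    using E N(1) by (simp add: complex_vector.span_subspace)
  ultimately show ?thesis by (simp only: complex_vector.span_Un spC)
qed

section \<open>Bounded complex functionals\<close>

definition cfunctional :: "('a::complex_normed_vector \<Rightarrow> complex) \<Rightarrow> bool"
  where "cfunctional f \<longleftrightarrow> bounded_linear f \<and> (\<forall>c x. f (c *\<^sub>C x) = c * f x)"

lemma cfunctionalD:
  assumes "cfunctional f"
  shows "bounded_linear f" "f (c *\<^sub>C x) = c * f x" "f (x + y) = f x + f y" "f (x - y) = f x - f y" "f 0 = 0"
    "f (sum u I) = (\<Sum>i\<in>I. f (u i))"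
proof -
  show f: "bounded_linear f" using assms by (simp add: cfunctional_def)
  then interpret bounded_linear f .
  show "f (c *\<^sub>C x) = c * f x" using assms by (simp add: cfunctional_def)
  show "f (x + y) = f x + f y" "f (x - y) = f x - f y" "f 0 = 0" "f (sum u I) = (\<Sum>i\<in>I. f (u i))"
    by (simp_all add: add diff sum)
qed

lemma sublinear_infdist:
  fixes C :: "'a::real_normed_vector set"
  assumes C: "subspace C"
  shows "sublinear (\<lambda>x. infdist x C)"
proof -
  have ne: "C \<noteq> {}" using subspace_0[OF C] by blast
  have ge: "b \<le> infdist x C" if "\<And>a. a \<in> C \<Longrightarrow> b \<le> norm (x - a)" for b and x
    unfolding infdist_notempty[OF ne] using that by (intro cINF_greatest[OF ne]) (simp add: dist_norm)
  have le: "infdist x C \<le> norm (x - a)" if "a \<in> C" for x a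
    using infdist_le[OF that, of x] by (simp add: dist_norm)
  have "infdist (x + y) C \<le> infdist x C + infdist y C" for x y
  proof -
    have "infdist (x + y) C - infdist y C \<le> infdist x C"
    proof (rule ge)
      fix a assume a: "a \<in> C"
      have "infdist (x + y) C - norm (x - a) \<le> infdist y C"
      proof (rule ge)
        fix b assume b: "b \<in> C"
        have "infdist (x + y) C \<le> norm ((x + y) - (a + b))"
          using a b C by (intro le subspace_add)
        also have "\<dots> \<le> norm (x - a) + norm (y - b)"
          using norm_triangle_ineq[of "x - a" "y - b"] by (simp add: algebra_simps)
        finally show "infdist (x + y) C - norm (x - a) \<le> norm (y - b)" by simp
      qed
      then show "infdist (x + y) C - infdist y C \<le> norm (x - a)" by simp
    qed
    then show ?thesis by simp
  qed
  moreover have "infdist (t *\<^sub>R x) C = t * infdist x C" if "t \<ge> 0" for t x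
  proof (cases "t = 0")
    case True
    then show ?thesis using subspace_0[OF C] by simp
  next
    case False
    with that have t: "t > 0" by simp
    have "infdist (t *\<^sub>R x) C / t \<le> infdist x C"
    proof (rule ge)
      fix a assume "a \<in> C"
      then have "infdist (t *\<^sub>R x) C \<le> norm (t *\<^sub>R x - t *\<^sub>R a)"
        using C by (intro le subspace_scale)
      also have "\<dots> = t * norm (x - a)" using t by (simp flip: scaleR_right_diff_distrib)
      finally show "infdist (t *\<^sub>R x) C / t \<le> norm (x - a)" using t by (simp add: field_simps)
    qed
    moreover have "t * infdist x C \<le> infdist (t *\<^sub>R x) C"
    proof (rule ge)
      fix a assume "a \<in> C"
      then have "infdist x C \<le> norm (x - (1/t) *\<^sub>R a)"
        using C by (intro le subspace_scale)
      then have "t * infdist x C \<le> norm (t *\<^sub>R (x - (1/t) *\<^sub>R a))" using t by simp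
      then show "t * infdist x C \<le> norm (t *\<^sub>R x - a)"
        using t by (simp add: scaleR_right_diff_distrib)
    qed
    ultimately show ?thesis using t by (simp add: field_simps)
  qed
  ultimately show ?thesis by (simp add: sublinear_def)
qed

text \<open>Hahn-Banach for the distance from \<open>C\<close>, which is sublinear and vanishes on \<open>C\<close>. The complex
  functional with real part \<open>g\<close> is \<open>g x - \<i> g (\<i> x)\<close>.\<close>

lemma exists_cfunctional_vanishing_on:
  fixes C :: "'a::complex_normed_vector set"
  assumes C: "csubspace C" "closed C" and e: "e \<notin> C"
  shows "\<exists>f. cfunctional f \<and> (\<forall>x\<in>C. f x = 0) \<and> f e = 1"
proof -
  have ne: "C \<noteq> {}" and C0: "0 \<in> C" using complex_vector.subspace_0[OF C(1)] by auto
  obtain g where g: "linear g" "\<And>x. g x \<le> infdist x C" "g e = infdist e C"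
    using hahn_banach_sublinear[OF sublinear_infdist[OF csubspace_imp_subspace[OF C(1)]], of e] by blast
  have ge: "g e > 0"
    using e in_closed_iff_infdist_zero[OF C(2) ne, of e] infdist_nonneg[of e C] g(3) by linarith
  have gneg: "g (- x) = - g x" for x using linear_neg[OF g(1)] .
  have gb: "\<bar>g x\<bar> \<le> norm x" for x
    using g(2)[of x] g(2)[of "- x"] gneg[of x] infdist_le[OF C0, of x] infdist_le[OF C0, of "- x"]
    by (simp add: abs_le_iff)
  have g0: "g x = 0" if "x \<in> C" for x
    using g(2)[of x] g(2)[of "- x"] gneg[of x] that complex_vector.subspace_neg[OF C(1) that] by simp
  define h where "h x = Complex (g x) (- g (\<i> *\<^sub>C x))" for x
  have hadd: "h (x + y) = h x + h y" for x y
    by (simp add: h_def complex_eq_iff linear_add[OF g(1)] scaleC_add_right)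
  have hR: "h (r *\<^sub>R x) = of_real r * h x" for r x
  proof -
    have "\<i> *\<^sub>C r *\<^sub>R x = r *\<^sub>R \<i> *\<^sub>C x" by (simp add: scaleR_eq_scaleC scaleC_left_commute)
    then show ?thesis by (simp add: h_def complex_eq_iff linear_scale[OF g(1)])
  qed
  have hi: "h (\<i> *\<^sub>C x) = \<i> * h x" for x
  proof -
    have "\<i> *\<^sub>C \<i> *\<^sub>C x = - x"
      using complex_vector.scale_minus_left[of 1 x] by (simp add: scaleC_scaleC scaleC_one)
    then show ?thesis by (simp add: h_def complex_eq_iff gneg)
  qed
  have hC: "h (c *\<^sub>C x) = c * h x" for c x
  proof -
    have "c *\<^sub>C x = Re c *\<^sub>R x + Im c *\<^sub>R \<i> *\<^sub>C x"
      by (simp add: scaleR_eq_scaleC scaleC_scaleC mult.commute complex_eq flip: scaleC_add_left)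
    then have "h (c *\<^sub>C x) = (of_real (Re c) + \<i> * of_real (Im c)) * h x"
      by (simp only: hadd hR hi) (simp add: algebra_simps)
    then show ?thesis by (simp flip: complex_eq)
  qed
  have hb: "norm (h x) \<le> norm x * 2" for x
  proof -
    have "norm (h x) \<le> \<bar>g x\<bar> + \<bar>g (\<i> *\<^sub>C x)\<bar>"
      using cmod_le[of "h x"] by (simp add: h_def)
    also have "\<dots> \<le> norm x + norm (\<i> *\<^sub>C x)" by (intro add_mono gb)
    finally show ?thesis by (simp add: norm_scaleC)
  qed
  have "h e \<noteq> 0" using ge by (auto simp: h_def complex_eq_iff)
  have "bounded_linear h"
    by (rule bounded_linear_intro[OF hadd _ hb]) (simp add: hR scaleR_conv_of_real)
  then have "bounded_linear (\<lambda>x. inverse (h e) * h x)"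
    by (rule bounded_linear_const_mult)
  then have "cfunctional (\<lambda>x. inverse (h e) * h x)"
    by (simp add: cfunctional_def hC)
  moreover have "h x = 0" if "x \<in> C" for x
    using that C(1) by (simp add: h_def g0 complex_vector.subspace_scale complex_eq_iff)
  ultimately show ?thesis
    using \<open>h e \<noteq> 0\<close> by (intro exI[of _ "\<lambda>x. inverse (h e) * h x"]) auto
qed

lemma exists_dual_family:
  fixes E :: "'a::complex_banach set"
  assumes E: "finite E" "\<not> cdependent E"
  shows "\<exists>f. (\<forall>e\<in>E. cfunctional (f e)) \<and> (\<forall>d\<in>E. \<forall>e\<in>E. f d e = (if d = e then 1 else 0))"
proof -
  have "\<exists>g. cfunctional g \<and> (\<forall>e\<in>E. g e = (if d = e then 1 else 0))" if d: "d \<in> E" for d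
  proof -
    have "d \<notin> cspan (E - {d})" using E(2) d by (auto simp: complex_vector.dependent_def)
    then obtain g where g: "cfunctional g" "\<forall>x\<in>cspan (E - {d}). g x = 0" "g d = 1"
      using exists_cfunctional_vanishing_on[of "cspan (E - {d})" d] closed_cspan_finite[of "E - {d}"] E(1)
      by auto
    then show ?thesis using complex_vector.span_base[of _ "E - {d}"] by (intro exI[of _ g]) auto
  qed
  then have "\<forall>d\<in>E. \<exists>g. cfunctional g \<and> (\<forall>e\<in>E. g e = (if d = e then 1 else 0))"
    by blast
  from bchoice[OF this] show ?thesis by blast
qed

text \<open>The operator \<open>x \<mapsto> f x *\<^sub>C y\<close>, also written \<open>y \<otimes> f\<close>. If \<open>f\<close> is not a bounded functional, the default
  value is the zero operator.\<close>

lift_definition rank_one :: "('a::complex_normed_vector \<Rightarrow> complex) \<Rightarrow> 'a \<Rightarrow> 'a bop"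
  is "\<lambda>f y x. if cfunctional f then f x *\<^sub>C y else 0"
proof -
  fix f :: "'a \<Rightarrow> complex" and y :: 'a
  show "bounded_linear (\<lambda>x. if cfunctional f then f x *\<^sub>C y else 0) \<and>
      (\<forall>c x. (if cfunctional f then f (c *\<^sub>C x) *\<^sub>C y else 0) = c *\<^sub>C (if cfunctional f then f x *\<^sub>C y else 0))"
  proof (cases "cfunctional f")
    case True
    interpret f: bounded_linear f using cfunctionalD(1)[OF True] .
    from bounded_linear_compose[OF bounded_linear_scaleC_left f.bounded_linear_axioms]
    have "bounded_linear (\<lambda>x. f x *\<^sub>C y)" .
    then show ?thesis
      using True by (simp add: cfunctionalD(2)[OF True] scaleC_scaleC)
  qed simp
qed

lemma rank_one_apply: "cfunctional f \<Longrightarrow> bop_apply (rank_one f y) x = f x *\<^sub>C y"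
  by transfer simp

section \<open>Nullity and defect\<close>

lemmas bop_rep_eq = plus_bop.rep_eq minus_bop.rep_eq uminus_bop.rep_eq zero_bop.rep_eq
  scaleC_bop.rep_eq times_bop.rep_eq one_bop.rep_eq

lemma bop_linear:
  "bop_apply T (x + y) = bop_apply T x + bop_apply T y"
  "bop_apply T (x - y) = bop_apply T x - bop_apply T y"
  "bop_apply T (- x) = - bop_apply T x"
  "bop_apply T 0 = 0"
  "bop_apply T (sum u I) = (\<Sum>i\<in>I. bop_apply T (u i))"
proof -
  interpret bounded_linear "bop_apply T" by (rule bounded_linear_bop_apply)
  show "bop_apply T (x + y) = bop_apply T x + bop_apply T y"
    "bop_apply T (x - y) = bop_apply T x - bop_apply T y" "bop_apply T (- x) = - bop_apply T x"
    "bop_apply T 0 = 0" "bop_apply T (sum u I) = (\<Sum>i\<in>I. bop_apply T (u i))"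
    by (simp_all add: add diff sum linear_neg[OF linear_axioms])
qed

lemma bop_pow_Suc:
  "bop_apply (T ^ Suc n) x = bop_apply T (bop_apply (T ^ n) x)"
  "bop_apply (T ^ Suc n) x = bop_apply (T ^ n) (bop_apply T x)"
  by (simp only: power_Suc times_bop.rep_eq, simp only: power_Suc2 times_bop.rep_eq)

lemma bop_pow_0: "bop_apply (T ^ 0) x = x"
  by (simp add: one_bop.rep_eq)

lemma bop_pow_add: "bop_apply (T ^ (m + n)) x = bop_apply (T ^ m) (bop_apply (T ^ n) x)"
  by (simp add: power_add times_bop.rep_eq)

lemma op_minus_apply: "bop_apply (op_minus T \<mu>) x = bop_apply T x - \<mu> *\<^sub>C x"
  by (simp add: op_minus_def bop_rep_eq)

lemma csubspace_image: "csubspace V \<Longrightarrow> csubspace (bop_apply T ` V)"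
  unfolding complex_vector.subspace_def
  by (auto simp: image_iff bop_linear(4) intro: bop_linear(1)[symmetric] bop_apply_scaleC[symmetric]
      exI bexI[of _ 0])

lemma csubspace_preimage: "csubspace V \<Longrightarrow> csubspace W \<Longrightarrow> csubspace {x \<in> V. bop_apply T x \<in> W}"
  by (auto simp: complex_vector.subspace_def bop_linear bop_apply_scaleC)

lemma csubspace_null_space_on: "csubspace V \<Longrightarrow> csubspace (null_space_on V T)"
  by (auto simp: null_space_on_def complex_vector.subspace_def bop_linear bop_apply_scaleC)

lemma csubspace_range: "csubspace (range (bop_apply T))"
  by (rule csubspace_image) simp

lemma findim_basis:
  assumes "V \<subseteq> cspan F" "finite F"
  obtains B where "finite B" "B \<subseteq> V" "\<not> cdependent B" "V \<subseteq> cspan B" "card B = cdim_nat V"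
    "card B \<le> card F"
proof -
  obtain B where B: "B \<subseteq> V" "\<not> cdependent B" "V \<subseteq> cspan B" "card B = cdim_nat V"
    using complex_vector.basis_exists[of V] by blast
  have "finite B \<and> card B \<le> card F"
    using complex_vector.independent_span_bound[OF assms(2) B(2) subset_trans[OF B(1) assms(1)]] .
  then show ?thesis using that[OF _ B] by blast
qed

lemma cdim_finite_iff: "cdim V < \<infinity> \<longleftrightarrow> (\<exists>F. finite F \<and> V \<subseteq> cspan F)"
  by (auto simp: cdim_def)

text \<open>Preimages of a basis of \<open>T ` V \<inter> W\<close>, together with the null space, span the preimage of \<open>W\<close>. The
  bound on \<open>card H\<close> is what allows dimensions to be compared later.\<close>

lemma findim_preimage:
  assumes V: "csubspace V" and F: "finite F" "null_space_on V T \<subseteq> cspan F"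
    and G: "finite G" "W \<subseteq> cspan G"
  shows "\<exists>H. finite H \<and> card H \<le> card F + card G \<and> {x \<in> V. bop_apply T x \<in> W} \<subseteq> cspan H"
proof -
  have "bop_apply T ` V \<inter> W \<subseteq> cspan G" using G by blast
  then obtain E where E: "finite E" "E \<subseteq> bop_apply T ` V \<inter> W"
      "bop_apply T ` V \<inter> W \<subseteq> cspan E" "card E \<le> card G"
    using findim_basis[OF _ G(1)] by metis
  have "\<forall>e\<in>E. \<exists>x. x \<in> V \<and> bop_apply T x = e" using E(2) by blast
  from bchoice[OF this] obtain p where p: "\<And>e. e \<in> E \<Longrightarrow> p e \<in> V \<and> bop_apply T (p e) = e" by blast
  define H where "H = F \<union> p ` E"
  have "card H \<le> card F + card G"
    unfolding H_def using card_Un_le[of F "p ` E"] card_image_le[OF E(1), of p] E(4) by linarith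
  moreover have "x \<in> cspan H" if x: "x \<in> V" "bop_apply T x \<in> W" for x
  proof -
    have "bop_apply T x \<in> cspan E" using E(3) x by blast
    then obtain u where u: "bop_apply T x = (\<Sum>e\<in>E. u e *\<^sub>C e)"
      unfolding complex_vector.span_finite[OF E(1)] by blast
    define y where "y = (\<Sum>e\<in>E. u e *\<^sub>C p e)"
    have yV: "y \<in> V" unfolding y_def
      using p V by (intro complex_vector.subspace_sum complex_vector.subspace_scale) auto
    have "bop_apply T y = bop_apply T x"
      unfolding y_def u by (simp add: bop_linear bop_apply_scaleC p)
    then have "x - y \<in> null_space_on V T"
      using x yV V by (simp add: null_space_on_def bop_linear complex_vector.subspace_diff)
    then have "x - y \<in> cspan H"
      using F(2) complex_vector.span_mono[of F H] unfolding H_def by blast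
    moreover have "y \<in> cspan H"
      unfolding y_def H_def
      by (intro complex_vector.span_sum complex_vector.span_scale complex_vector.span_base) auto
    ultimately show ?thesis using complex_vector.span_add by fastforce
  qed
  ultimately show ?thesis using F(1) E(1) by (intro exI[of _ H]) (auto simp: H_def)
qed

lemma independent_complement:
  assumes B: "\<not> cdependent B" "finite B" and C: "C \<subseteq> B"
    and y: "(\<Sum>b\<in>B - C. c b *\<^sub>C b) \<in> cspan C" and b: "b \<in> B - C"
  shows "c b = 0"
proof -
  obtain d where d: "(\<Sum>b\<in>B - C. c b *\<^sub>C b) = (\<Sum>b\<in>C. d b *\<^sub>C b)"
    using y unfolding complex_vector.span_finite[OF finite_subset[OF C B(2)]] by blast
  define w where "w b = (if b \<in> C then - d b else c b)" for b
  have "(\<Sum>b\<in>B. w b *\<^sub>C b) = (\<Sum>b\<in>B - C. w b *\<^sub>C b) + (\<Sum>b\<in>C. w b *\<^sub>C b)"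
    by (rule sum.subset_diff[OF C B(2)])
  also have "(\<Sum>b\<in>B - C. w b *\<^sub>C b) = (\<Sum>b\<in>C. d b *\<^sub>C b)"
    unfolding d[symmetric] by (rule sum.cong) (auto simp: w_def)
  also have "(\<Sum>b\<in>C. w b *\<^sub>C b) = - (\<Sum>b\<in>C. d b *\<^sub>C b)"
    by (simp add: w_def sum_negf)
  finally have "(\<Sum>b\<in>B. w b *\<^sub>C b) = 0" by simp
  then have "w b = 0"
    using complex_vector.independentD[OF B(1,2) subset_refl, of w b] b by simp
  then show ?thesis using b by (simp add: w_def)
qed

text \<open>Let \<open>D\<close> be the preimage of \<open>W\<close>. It contains the null space, so by rank and nullity the
  dimension of \<open>T ` D = W \<inter> T ` V\<close> is \<open>dim D - alpha \<le> dim W - alpha\<close>. Hence \<open>W / (W \<inter> T ` V)\<close> has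
  dimension at least \<open>alpha\<close>, and it embeds into \<open>V / T ` V\<close>. All counting takes place
  inside finite-dimensional spaces, so infinite \<open>beta\<close> is covered without separate treatment.\<close>

lemma alpha_le_beta_of_small_preimage:
  assumes V: "csubspace V" and W: "csubspace W" "W \<subseteq> V" "finite F" "W \<subseteq> cspan F"
    and G: "finite G" "{x \<in> V. bop_apply T x \<in> W} \<subseteq> cspan G" "card G \<le> cdim_nat W"
  shows "alpha_on V T < \<infinity> \<and> alpha_on V T \<le> beta_on V T"
proof -
  define D where "D = {x \<in> V. bop_apply T x \<in> W}"
  define N where "N = null_space_on V T"
  have D: "csubspace D" unfolding D_def by (rule csubspace_preimage[OF V W(1)])
  have ND: "N \<subseteq> D"
    using complex_vector.subspace_0[OF W(1)] by (auto simp: N_def D_def null_space_on_def)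
  have DG: "D \<subseteq> cspan G" using G(2) by (simp add: D_def)
  obtain BN where BN: "finite BN" "BN \<subseteq> N" "\<not> cdependent BN" "N \<subseteq> cspan BN" "card BN = cdim_nat N"
    using findim_basis[OF subset_trans[OF ND DG] G(1)] by metis
  have fin: "alpha_on V T = enat (card BN)"
    unfolding alpha_on_def cdim_def N_def[symmetric] using BN(1,4,5) by auto
  obtain BD where BD: "BN \<subseteq> BD" "BD \<subseteq> D" "\<not> cdependent BD" "D \<subseteq> cspan BD"
    using complex_vector.maximal_independent_subset_extend[OF subset_trans[OF BN(2) ND] BN(3)] by blast
  have BDf: "finite BD" "card BD \<le> card G"
    using complex_vector.independent_span_bound[OF G(1) BD(3) subset_trans[OF BD(2) DG]] by auto
  \<comment> \<open>A spanning set of \<open>W \<inter> T ` V\<close> with at most \<open>dim D - alpha\<close> elements.\<close>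
  define C where "C = bop_apply T ` (BD - BN)"
  have C: "finite C" "card C \<le> card BD - card BN" "C \<subseteq> W"
    using BDf(1) BD(1,2) card_image_le[of "BD - BN" "bop_apply T"] card_Diff_subset[OF BN(1) BD(1)]
    by (auto simp: C_def D_def)
  have TD: "bop_apply T x \<in> cspan C" if "x \<in> D" for x
  proof -
    have "x \<in> cspan BD" using that BD(4) by blast
    then obtain u where u: "x = (\<Sum>b\<in>BD. u b *\<^sub>C b)"
      unfolding complex_vector.span_finite[OF BDf(1)] by blast
    have "bop_apply T b \<in> cspan C" if b: "b \<in> BD" for b
    proof (cases "b \<in> BN")
      case True
      then have "bop_apply T b = 0" using BN(2) by (auto simp: N_def null_space_on_def)
      then show ?thesis by (simp add: complex_vector.span_zero)
    next
      case False
      then show ?thesis using b by (intro complex_vector.span_base) (auto simp: C_def)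
    qed
    then show ?thesis
      unfolding u bop_linear bop_apply_scaleC
      by (intro complex_vector.span_sum complex_vector.span_scale)
  qed
  obtain C' where C': "C' \<subseteq> C" "\<not> cdependent C'" "C \<subseteq> cspan C'"
    using complex_vector.maximal_independent_subset[of C] by blast
  have C'f: "finite C'" "card C' \<le> card C" using C'(1) C(1) by (auto intro: finite_subset card_mono)
  obtain BW where BW: "C' \<subseteq> BW" "BW \<subseteq> W" "\<not> cdependent BW" "W \<subseteq> cspan BW"
    using complex_vector.maximal_independent_subset_extend[OF subset_trans[OF C'(1) C(3)] C'(2)] by blast
  have BWf: "finite BW"
    using complex_vector.independent_span_bound[OF W(3) BW(3) subset_trans[OF BW(2) W(4)]] by auto
  have cardW: "card BW = cdim_nat W"
    by (rule complex_vector.basis_card_eq_dim[OF BW(2,4,3)])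
  \<comment> \<open>A basis of a complement of \<open>W \<inter> T ` V\<close> in \<open>W\<close>.\<close>
  define P where "P = BW - C'"
  have P: "finite P" "P \<subseteq> W" "card P = card BW - card C'"
    using BWf BW(1,2) C'f by (auto simp: P_def card_Diff_subset)
  have "card BN \<le> card BD" using card_mono[OF BDf(1) BD(1)] .
  then have cardP: "card BN \<le> card P"
    using P(3) cardW G(3) BDf(2) C(2) C'f(2) by linarith
  have zero: "c b = 0" if c: "(\<Sum>b\<in>P. c b *\<^sub>C b) \<in> bop_apply T ` V" and b: "b \<in> P" for c b
  proof -
    define y where "y = (\<Sum>b\<in>P. c b *\<^sub>C b)"
    obtain x where x: "x \<in> V" "y = bop_apply T x" using c by (auto simp: y_def)
    have "y \<in> W" unfolding y_def
      using P(2) W(1) by (intro complex_vector.subspace_sum complex_vector.subspace_scale) auto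
    then have "y \<in> cspan C" using TD x by (simp add: D_def)
    then have "y \<in> cspan C'"
      using complex_vector.span_mono[OF C'(3)] by (simp add: complex_vector.span_span subset_iff)
    then show ?thesis
      using independent_complement[OF BW(3) BWf BW(1)] b unfolding y_def P_def by blast
  qed
  have "enat (card P) \<le> beta_on V T"
    unfolding beta_on_def quotient_cdim_def
    using P(1,2) W(2) zero by (intro SUP_upper) auto
  moreover have "enat (card BN) \<le> enat (card P)" using cardP by simp
  ultimately have "enat (card BN) \<le> beta_on V T" by (rule order_trans[rotated])
  then show ?thesis unfolding fin by simp
qed

lemma index_on_pos_iff:
  "alpha_on V T < \<infinity> \<Longrightarrow> 0 < index_on V T \<longleftrightarrow> beta_on V T < alpha_on V T"
  unfolding index_on_def by (cases "alpha_on V T"; cases "beta_on V T") auto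

lemma findim_null_space_pow:
  assumes V: "csubspace V" "bop_apply T ` V \<subseteq> V" and fin: "alpha_on V T < \<infinity>"
  shows "\<exists>F. finite F \<and> null_space_on V (T ^ k) \<subseteq> cspan F"
proof (induction k)
  case 0
  then show ?case by (intro exI[of _ "{}"]) (auto simp: null_space_on_def one_bop.rep_eq)
next
  case (Suc k)
  then obtain G where G: "finite G" "null_space_on V (T ^ k) \<subseteq> cspan G" by blast
  obtain F where F: "finite F" "null_space_on V T \<subseteq> cspan F"
    using fin[unfolded alpha_on_def cdim_finite_iff] by blast
  have "null_space_on V (T ^ Suc k) \<subseteq> {x \<in> V. bop_apply T x \<in> null_space_on V (T ^ k)}"
    using V(2) by (auto simp: null_space_on_def bop_pow_Suc(2) simp del: power_Suc)
  then show ?case using findim_preimage[OF V(1) F G] by blast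
qed

text \<open>With \<open>p\<close> at or beyond the ascent, \<open>W = N (T\<^sup>p) \<inter> V\<close> equals its own preimage in \<open>V\<close>.\<close>

lemma alpha_le_beta_of_finite_ascent:
  assumes V: "csubspace V" "bop_apply T ` V \<subseteq> V" and fin: "alpha_on V T < \<infinity>"
    and asc: "null_space (T ^ Suc p) = null_space (T ^ p)"
  shows "alpha_on V T \<le> beta_on V T"
proof -
  define W where "W = null_space_on V (T ^ p)"
  obtain F where F: "finite F" "W \<subseteq> cspan F"
    unfolding W_def using findim_null_space_pow[OF V fin] by blast
  obtain B where B: "finite B" "W \<subseteq> cspan B" "card B = cdim_nat W"
    using findim_basis[OF F(2,1)] by metis
  have W: "csubspace W" "W \<subseteq> V"
    unfolding W_def using csubspace_null_space_on[OF V(1)] by (auto simp: null_space_on_def)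
  have "{x \<in> V. bop_apply T x \<in> W} \<subseteq> W"
  proof
    fix x assume "x \<in> {x \<in> V. bop_apply T x \<in> W}"
    then have x: "x \<in> V" "x \<in> null_space (T ^ Suc p)"
      by (auto simp: W_def null_space_on_def bop_pow_Suc(2) simp del: power_Suc)
    then show "x \<in> W" unfolding asc by (simp add: W_def null_space_on_def)
  qed
  then show ?thesis
    using alpha_le_beta_of_small_preimage[OF V(1) W F B(1), of T] B(2,3) by auto
qed

section \<open>Operators bounded below on a subspace\<close>

lemma lower_bound_of_closed_injective:
  fixes T :: "'a::complex_banach bop"
  assumes V: "csubspace V" "closed V" and inj: "null_space_on V T \<subseteq> {0}" and cl: "closed (bop_apply T ` V)"
  shows "\<exists>c>0. \<forall>x\<in>V. c * norm x \<le> norm (bop_apply T x)"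
proof -
  obtain C where C: "C > 0" "\<forall>y\<in>bop_apply T ` V. \<exists>x\<in>V. bop_apply T x = y \<and> norm x \<le> C * norm y"
    using closed_image_imp_bounded_preimages[OF bounded_linear_bop_apply csubspace_imp_subspace[OF V(1)] V(2) cl]
    by blast
  have "inverse C * norm x \<le> norm (bop_apply T x)" if x: "x \<in> V" for x
  proof -
    obtain x' where x': "x' \<in> V" "bop_apply T x' = bop_apply T x" "norm x' \<le> C * norm (bop_apply T x)"
      using C(2) x by blast
    have "x' - x \<in> null_space_on V T"
      using x x' V(1) by (simp add: null_space_on_def bop_linear complex_vector.subspace_diff)
    then have "x' = x" using inj by auto
    then show ?thesis using x'(3) C(1) by (simp add: field_simps)
  qed
  then show ?thesis using C(1) by (intro exI[of _ "inverse C"]) simp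
qed

lemma closed_image_of_lower_bound:
  fixes T :: "'a::complex_banach bop"
  assumes V: "csubspace V" "closed V" and c: "c > 0" "\<And>x. x \<in> V \<Longrightarrow> c * norm x \<le> norm (bop_apply T x)"
  shows "closed (bop_apply T ` V)"
proof (rule bounded_preimages_imp_closed_image[OF bounded_linear_bop_apply csubspace_imp_subspace[OF V(1)] V(2)])
  show "inverse c > 0" using c(1) by simp
  show "\<exists>x'\<in>V. bop_apply T x' = bop_apply T x \<and> norm x' \<le> inverse c * norm (bop_apply T x)" if "x \<in> V" for x
    using c(1) c(2)[OF that] that by (intro bexI[of _ x]) (auto simp: field_simps)
qed

lemma lower_bound_op_minus:
  assumes c: "c * norm x \<le> norm (bop_apply T x)" and \<nu>: "cmod \<nu> \<le> c / 2"
  shows "c / 2 * norm x \<le> norm (bop_apply (op_minus T \<nu>) x)"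
proof -
  have "norm (bop_apply T x) - norm (\<nu> *\<^sub>C x) \<le> norm (bop_apply (op_minus T \<nu>) x)"
    unfolding op_minus_apply by (rule norm_triangle_ineq2)
  moreover have "norm (\<nu> *\<^sub>C x) \<le> c / 2 * norm x"
    using mult_right_mono[OF \<nu> norm_ge_zero] by (simp add: norm_scaleC)
  ultimately show ?thesis using c by (simp add: field_simps)
qed

lemma null_space_of_lower_bound:
  assumes "c > 0" "\<And>x. x \<in> V \<Longrightarrow> c * norm x \<le> norm (bop_apply T x)"
  shows "null_space_on V T \<subseteq> {0}"
proof
  fix x assume "x \<in> null_space_on V T"
  then have "c * norm x \<le> 0" using assms(2)[of x] by (simp add: null_space_on_def)
  then show "x \<in> {0}" using assms(1) by (simp add: mult_le_0_iff)
qed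

section \<open>Null spaces and ranges of powers\<close>

lemma image_range_pow: "bop_apply T ` range (bop_apply (T ^ n)) = range (bop_apply (T ^ Suc n))"
  unfolding image_image bop_pow_Suc(1)[symmetric] ..

lemma range_pow_antimono: "m \<le> n \<Longrightarrow> range (bop_apply (T ^ n)) \<subseteq> range (bop_apply (T ^ m))"
  by (metis bop_pow_add image_subsetI le_add_diff_inverse rangeI)

lemma null_space_pow_stable_iff:
  "null_space (T ^ n) = null_space (T ^ Suc n) \<longleftrightarrow> null_space T \<inter> range (bop_apply (T ^ n)) \<subseteq> {0}"
proof -
  have "null_space (T ^ n) \<subseteq> null_space (T ^ Suc n)"
    by (auto simp: null_space_on_def bop_pow_Suc(1) bop_linear simp del: power_Suc)
  then show ?thesis
    by (auto simp: null_space_on_def bop_pow_Suc(1) simp del: power_Suc)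
qed

lemma null_space_pow_stable_mono:
  assumes "null_space (T ^ a) = null_space (T ^ Suc a)" "a \<le> k"
  shows "null_space (T ^ k) = null_space (T ^ Suc k)"
  using assms range_pow_antimono[OF assms(2), of T] unfolding null_space_pow_stable_iff by blast

text \<open>This sum is the preimage of the range of \<open>T ^ (j + k)\<close> under \<open>T ^ j\<close>.\<close>

lemma closed_preimage_range_pow:
  fixes T :: "'a::complex_banach bop"
  assumes "closed (range (bop_apply (T ^ (j + k))))"
  shows "closed {bop_apply (T ^ k) v + w | v w. v \<in> UNIV \<and> w \<in> null_space (T ^ j)}"
proof -
  have "{bop_apply (T ^ k) v + w | v w. v \<in> UNIV \<and> w \<in> null_space (T ^ j)}
      = bop_apply (T ^ j) -` range (bop_apply (T ^ (j + k)))" (is "?L = ?R")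
  proof
    show "?L \<subseteq> ?R" by (auto simp: null_space_on_def bop_linear bop_pow_add)
    show "?R \<subseteq> ?L"
    proof
      fix x assume "x \<in> ?R"
      then obtain v where "bop_apply (T ^ j) x = bop_apply (T ^ j) (bop_apply (T ^ k) v)"
        by (auto simp: bop_pow_add)
      then have "x - bop_apply (T ^ k) v \<in> null_space (T ^ j)"
        by (simp add: null_space_on_def bop_linear)
      moreover have "x = bop_apply (T ^ k) v + (x - bop_apply (T ^ k) v)" by simp
      ultimately show "x \<in> ?L" by blast
    qed
  qed
  moreover have "closed ?R"
    by (rule closed_vimage[OF assms])
      (rule linear_continuous_on[OF bounded_linear_bop_apply])
  ultimately show ?thesis by simp
qed

lemma closed_null_space: "closed (null_space T)"
proof -
  have "null_space T = bop_apply T -` {0}" by (auto simp: null_space_on_def)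
  then show ?thesis
    using closed_vimage[OF closed_singleton[of 0] linear_continuous_on[OF bounded_linear_bop_apply[of T]]]
    by simp
qed

text \<open>From the ascent on, the null space of \<open>T\<close> meets the range of \<open>T ^ k\<close> trivially, and their sum is
  the preimage of the range of \<open>T ^ Suc k\<close>; so closedness descends by one exponent at a time.\<close>

lemma closed_range_pow_below:
  fixes T :: "'a::complex_banach bop"
  assumes asc: "null_space (T ^ a) = null_space (T ^ Suc a)" and "a \<le> j" "j \<le> k"
    and cl: "closed (range (bop_apply (T ^ k)))"
  shows "closed (range (bop_apply (T ^ j)))"
  using \<open>j \<le> k\<close> cl
proof (induction k rule: dec_induct)
  case (step k)
  have "null_space T \<inter> range (bop_apply (T ^ k)) \<subseteq> {0}"
    using null_space_pow_stable_mono[OF asc, of k] \<open>a \<le> j\<close> step(1)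
    unfolding null_space_pow_stable_iff by simp
  moreover have "closed {bop_apply (T ^ k) v + w | v w. v \<in> UNIV \<and> w \<in> null_space T}"
    using closed_preimage_range_pow[of T 1 k] step.prems by simp
  ultimately have "closed (range (bop_apply (T ^ k)))"
    by (intro closed_image_of_closed_direct_summand[OF bounded_linear_bop_apply, of UNIV "null_space T"]
        csubspace_imp_subspace csubspace_null_space_on closed_null_space) auto
  then show ?case by (rule step.IH)
qed

text \<open>Replacing \<open>N\<close> by a complement of \<open>N \<inter> range T\<close> in \<open>N\<close> keeps the sum and makes it direct.\<close>

lemma closed_range_of_closed_plus_findim:
  fixes T :: "'a::complex_banach bop"
  assumes N: "csubspace N" "N \<subseteq> cspan F" "finite F"
    and cl: "closed {bop_apply T v + w | v w. v \<in> UNIV \<and> w \<in> N}"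
  shows "closed (range (bop_apply T))"
proof -
  define R where "R = range (bop_apply T)"
  have R: "csubspace R" unfolding R_def by (rule csubspace_range)
  obtain C where C: "C \<subseteq> N \<inter> R" "\<not> cdependent C" "N \<inter> R \<subseteq> cspan C"
    using complex_vector.maximal_independent_subset[of "N \<inter> R"] by blast
  then have CN: "C \<subseteq> N" by blast
  obtain B where B: "C \<subseteq> B" "B \<subseteq> N" "\<not> cdependent B" "N \<subseteq> cspan B"
    using complex_vector.maximal_independent_subset_extend[OF CN C(2)] by blast
  have Bf: "finite B"
    using complex_vector.independent_span_bound[OF N(3) B(3) subset_trans[OF B(2) N(2)]] by auto
  define G where "G = cspan (B - C)"
  have "range (bop_apply T) \<inter> G \<subseteq> {0}"
  proof
    fix y assume "y \<in> range (bop_apply T) \<inter> G"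
    then have y: "y \<in> R" "y \<in> cspan (B - C)" by (auto simp: R_def G_def)
    obtain c where c: "y = (\<Sum>b\<in>B - C. c b *\<^sub>C b)"
      using y(2) Bf by (auto simp: complex_vector.span_finite)
    have "y \<in> N"
      unfolding c using B(2) N(1) by (intro complex_vector.subspace_sum complex_vector.subspace_scale) auto
    then have "y \<in> cspan C" using y(1) C(3) by blast
    then have "c b = 0" if "b \<in> B - C" for b
      using independent_complement[OF B(3) Bf B(1) _ that, of c] c by simp
    then show "y \<in> {0}" unfolding c by simp
  qed
  moreover have "{bop_apply T v + w | v w. v \<in> UNIV \<and> w \<in> N} = {bop_apply T v + w | v w. v \<in> UNIV \<and> w \<in> G}"
  proof (intro equalityI subsetI)
    fix x assume "x \<in> {bop_apply T v + w | v w. v \<in> UNIV \<and> w \<in> G}"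
    then show "x \<in> {bop_apply T v + w | v w. v \<in> UNIV \<and> w \<in> N}"
      using complex_vector.span_minimal[of "B - C" N] B(2) N(1) unfolding G_def by blast
  next
    fix x assume "x \<in> {bop_apply T v + w | v w. v \<in> UNIV \<and> w \<in> N}"
    then obtain v w where vw: "x = bop_apply T v + w" "w \<in> N" by blast
    have "w \<in> cspan (C \<union> (B - C))" using vw(2) B(1,4) by (simp add: Un_absorb1 subset_iff)
    then obtain w1 w2 where w: "w = w1 + w2" "w1 \<in> cspan C" "w2 \<in> G"
      unfolding complex_vector.span_Un G_def by blast
    have "w1 \<in> R" using w(2) complex_vector.span_minimal[OF _ R, of C] C(1) by blast
    then obtain v1 where "w1 = bop_apply T v1" unfolding R_def by blast
    then have "x = bop_apply T (v + v1) + w2" by (simp add: vw(1) w(1) bop_linear)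
    then show "x \<in> {bop_apply T v + w | v w. v \<in> UNIV \<and> w \<in> G}" using w(3) by blast
  qed
  ultimately show ?thesis
    using cl closed_cspan_finite[of "B - C"] Bf
    by (intro closed_image_of_closed_direct_summand[OF bounded_linear_bop_apply, of UNIV G]
        csubspace_imp_subspace) (auto simp: G_def)
qed

lemma closed_range_of_closed_range_pow:
  fixes T :: "'a::complex_banach bop"
  assumes fin: "alpha T < \<infinity>" and cl: "closed (range (bop_apply (T ^ Suc k)))"
  shows "closed (range (bop_apply T))"
proof -
  obtain F where F: "finite F" "null_space (T ^ k) \<subseteq> cspan F"
    using findim_null_space_pow[of UNIV T k] fin by auto
  have "closed {bop_apply T v + w | v w. v \<in> UNIV \<and> w \<in> null_space (T ^ k)}"
    using closed_preimage_range_pow[of T k 1] cl by simp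
  then show ?thesis
    by (rule closed_range_of_closed_plus_findim[OF csubspace_null_space_on F(2,1), rotated]) simp
qed

section \<open>Passing from the range of a power to the whole space\<close>

text \<open>For \<open>\<nu> \<noteq> 0\<close> this is a Bezout relation between \<open>t - \<nu>\<close> and \<open>t ^ n\<close>: the operator \<open>T - \<nu>\<close> is
  invertible modulo the range of \<open>T ^ n\<close>, and the facts below carry over properties of \<open>T - \<nu>\<close> on this
  range to the whole space.\<close>

lemma pow_eq_scaleC_plus:
  "\<exists>Q. (\<forall>x. bop_apply (T ^ n) x = \<nu> ^ n *\<^sub>C x + bop_apply (op_minus T \<nu>) (bop_apply Q x)) \<and> Q * T = T * Q"
proof (induction n)
  case 0
  then show ?case by (intro exI[of _ 0]) (simp add: bop_rep_eq bop_linear scaleC_one)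
next
  case (Suc n)
  then obtain Q where Q: "\<And>x. bop_apply (T ^ n) x = \<nu> ^ n *\<^sub>C x + bop_apply (op_minus T \<nu>) (bop_apply Q x)"
    and comm: "Q * T = T * Q" by blast
  have c: "bop_apply T (bop_apply Q x) = bop_apply Q (bop_apply T x)" for x
    using comm by (metis times_bop.rep_eq)
  show ?case
  proof (intro exI[of _ "\<nu> ^ n *\<^sub>C 1 + T * Q"] conjI allI)
    show "bop_apply (T ^ Suc n) x
        = \<nu> ^ Suc n *\<^sub>C x + bop_apply (op_minus T \<nu>) (bop_apply (\<nu> ^ n *\<^sub>C 1 + T * Q) x)" for x
      unfolding bop_pow_Suc(1) Q op_minus_apply
      by (simp add: bop_rep_eq bop_linear bop_apply_scaleC algebra_simps scaleC_scaleC
          complex_vector.scale_right_diff_distrib scaleC_add_right)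
    show "(\<nu> ^ n *\<^sub>C 1 + T * Q) * T = T * (\<nu> ^ n *\<^sub>C 1 + T * Q)"
      by (rule bop_eqI) (simp add: bop_rep_eq bop_linear bop_apply_scaleC c)
  qed
qed

lemma op_minus_pow_commute:
  "bop_apply (T ^ n) (bop_apply (op_minus T \<nu>) x) = bop_apply (op_minus T \<nu>) (bop_apply (T ^ n) x)"
  by (simp only: op_minus_apply bop_linear bop_apply_scaleC flip: bop_pow_Suc)

lemma closed_range_op_minus:
  fixes T :: "'a::complex_banach bop"
  assumes \<nu>: "\<nu> \<noteq> 0" and cl: "closed (bop_apply (op_minus T \<nu>) ` range (bop_apply (T ^ n)))"
  shows "closed (range (bop_apply (op_minus T \<nu>)))"
proof -
  define S where "S = op_minus T \<nu>"
  obtain Q where Q: "\<And>x. bop_apply (T ^ n) x = \<nu> ^ n *\<^sub>C x + bop_apply S (bop_apply Q x)"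
    using pow_eq_scaleC_plus[of T n \<nu>] unfolding S_def by blast
  have R: "csubspace (range (bop_apply S))" by (rule csubspace_range)
  show ?thesis
    unfolding S_def[symmetric] closed_sequential_limits
  proof (intro allI impI, elim conjE)
    fix y l assume y: "\<forall>n. y n \<in> range (bop_apply S)" and l: "y \<longlonglongrightarrow> l"
    have "bop_apply (T ^ n) (y k) \<in> bop_apply S ` range (bop_apply (T ^ n))" for k
      using y[rule_format, of k] op_minus_pow_commute[of T n \<nu>] by (auto simp: S_def)
    then have "bop_apply (T ^ n) l \<in> bop_apply S ` range (bop_apply (T ^ n))"
      by (rule closed_sequentially[OF cl[folded S_def] _ bounded_linear.tendsto[OF bounded_linear_bop_apply l]])
    then have "bop_apply (T ^ n) l - bop_apply S (bop_apply Q l) \<in> range (bop_apply S)"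
      by (intro complex_vector.subspace_diff[OF R]) auto
    then have "\<nu> ^ n *\<^sub>C l \<in> range (bop_apply S)" by (simp add: Q)
    from complex_vector.subspace_scale[OF R this, of "inverse (\<nu> ^ n)"]
    show "l \<in> range (bop_apply S)" using \<nu> by (simp add: scaleC_scaleC scaleC_one)
  qed
qed

lemma preimage_op_minus_range_pow:
  assumes \<nu>: "\<nu> \<noteq> 0" and y: "bop_apply (op_minus T \<nu>) x \<in> range (bop_apply (T ^ n))"
  shows "x \<in> range (bop_apply (T ^ n))"
proof -
  define S where "S = op_minus T \<nu>"
  obtain Q where Q: "\<And>x. bop_apply (T ^ n) x = \<nu> ^ n *\<^sub>C x + bop_apply S (bop_apply Q x)"
    and comm: "Q * T = T * Q"
    using pow_eq_scaleC_plus[of T n \<nu>] unfolding S_def by blast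
  have cT: "bop_apply T (bop_apply Q z) = bop_apply Q (bop_apply T z)" for z
    using comm by (metis times_bop.rep_eq)
  have cTn: "bop_apply (T ^ n) (bop_apply Q z) = bop_apply Q (bop_apply (T ^ n) z)" for z
    by (induction n arbitrary: z) (simp_all add: bop_pow_0 bop_pow_Suc(1) cT del: power_Suc power.power_0)
  have R: "csubspace (range (bop_apply (T ^ n)))" by (rule csubspace_range)
  obtain z where z: "bop_apply S x = bop_apply (T ^ n) z" using y by (auto simp: S_def)
  have "bop_apply S (bop_apply Q x) = bop_apply Q (bop_apply S x)"
    by (simp add: S_def op_minus_apply bop_linear bop_apply_scaleC cT)
  also have "\<dots> = bop_apply (T ^ n) (bop_apply Q z)" by (simp add: z cTn)
  finally have "\<nu> ^ n *\<^sub>C x = bop_apply (T ^ n) x - bop_apply (T ^ n) (bop_apply Q z)"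
    by (simp add: Q)
  also have "\<dots> \<in> range (bop_apply (T ^ n))" by (intro complex_vector.subspace_diff[OF R]) auto
  finally have "\<nu> ^ n *\<^sub>C x \<in> range (bop_apply (T ^ n))" .
  from complex_vector.subspace_scale[OF R this, of "inverse (\<nu> ^ n)"]
  show ?thesis using \<nu> by (simp add: scaleC_scaleC scaleC_one)
qed

section \<open>Stability of a non-positive index\<close>

text \<open>The supremum that defines \<open>beta_on\<close> ranges over families of any size; here one of the exact size \<open>k\<close>
  is extracted.\<close>

lemma beta_on_ge_obtains_independent:
  assumes "enat k \<le> beta_on V T"
  obtains B where "finite B" "B \<subseteq> V" "card B = k"
    "\<And>c b. (\<Sum>b\<in>B. c b *\<^sub>C b) \<in> bop_apply T ` V \<Longrightarrow> b \<in> B \<Longrightarrow> c b = 0"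
proof -
  define \<B> where "\<B> = {B. finite B \<and> B \<subseteq> V \<and>
    (\<forall>c. (\<Sum>b\<in>B. c b *\<^sub>C b) \<in> bop_apply T ` V \<longrightarrow> (\<forall>b\<in>B. c b = 0))}"
  have "\<exists>B\<in>\<B>. k \<le> card B"
  proof (rule ccontr)
    assume "\<not> ?thesis"
    then have *: "card B < k" if "B \<in> \<B>" for B using that by (meson not_le)
    show False
    proof (cases k)
      case 0
      have "{} \<in> \<B>" by (simp add: \<B>_def)
      then show False using * 0 by blast
    next
      case (Suc j)
      then have "(SUP B\<in>\<B>. enat (card B)) \<le> enat j"
        using * by (intro SUP_least) (simp add: less_Suc_eq_le)
      with assms have "enat k \<le> enat j"
        unfolding beta_on_def quotient_cdim_def \<B>_def[symmetric] by (rule order_trans)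
      then show False using Suc by simp
    qed
  qed
  then obtain B where B: "B \<in> \<B>" "k \<le> card B" by blast
  obtain B' where B': "B' \<subseteq> B" "card B' = k" using obtain_subset_with_card_n[OF B(2)] by blast
  have Bf: "finite B" using B(1) by (simp add: \<B>_def)
  show ?thesis
  proof (rule that[of B'])
    show "finite B'" "B' \<subseteq> V" using B' B(1) Bf by (auto simp: \<B>_def intro: finite_subset)
    show "c b = 0" if c: "(\<Sum>b\<in>B'. c b *\<^sub>C b) \<in> bop_apply T ` V" and b: "b \<in> B'" for c b
    proof -
      have "(\<Sum>b\<in>B. (if b \<in> B' then c b else 0) *\<^sub>C b) = (\<Sum>b\<in>B'. c b *\<^sub>C b)"
        by (rule sum.mono_neutral_cong_right[OF Bf B'(1)]) auto
      with c have "(\<Sum>b\<in>B. (if b \<in> B' then c b else 0) *\<^sub>C b) \<in> bop_apply T ` V" by simp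
      with B(1) have "\<forall>b\<in>B. (if b \<in> B' then c b else 0) = 0"
        unfolding \<B>_def mem_Collect_eq by (elim conjE) (erule allE, erule mp)
      from bspec[OF this subsetD[OF B'(1) b]] show ?thesis using b by simp
    qed
  qed (rule B'(2))
qed

lemma sum_bop_apply: "bop_apply (sum u I) x = (\<Sum>i\<in>I. bop_apply (u i) x)"
  by (induction I rule: infinite_finite_induct) (simp_all add: bop_rep_eq)

text \<open>With \<open>E\<close> a basis of the null space and \<open>B\<close> a family of the same size independent modulo the range, \<open>F\<close> maps
  \<open>E\<close> bijectively to \<open>B\<close> and vanishes on the common kernel of the dual functionals \<open>f e\<close>. Then
  \<open>T + F\<close> is injective and its range is the closed space \<open>T ` V + span B\<close>.\<close>

lemma finite_rank_correction:
  fixes T :: "'a::complex_banach bop"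
  assumes V: "csubspace V" "closed V" "bop_apply T ` V \<subseteq> V" and cl: "closed (bop_apply T ` V)"
    and fin: "alpha_on V T < \<infinity>" and le: "alpha_on V T \<le> beta_on V T"
  obtains E B f F c where "finite E" "E \<subseteq> V" "finite B" "B \<subseteq> V" "\<not> cdependent B" "card B = card E"
    "\<forall>e\<in>E. cfunctional (f e)" "\<forall>d\<in>E. \<forall>e\<in>E. f d e = (if d = e then 1 else 0)"
    "\<forall>x. bop_apply F x \<in> cspan B" "\<forall>x. (\<forall>e\<in>E. f e x = 0) \<longrightarrow> bop_apply F x = 0"
    "c > 0" "\<forall>x\<in>V. c * norm x \<le> norm (bop_apply (T + F) x)"
proof -
  obtain F0 where F0: "finite F0" "null_space_on V T \<subseteq> cspan F0"
    using fin[unfolded alpha_on_def cdim_finite_iff] by blast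
  obtain E where E: "finite E" "E \<subseteq> null_space_on V T" "\<not> cdependent E" "null_space_on V T \<subseteq> cspan E"
      "card E = cdim_nat (null_space_on V T)"
    using findim_basis[OF F0(2,1)] by metis
  have "alpha_on V T = enat (card E)"
    unfolding alpha_on_def cdim_def using E(1,4,5) by auto
  then have "enat (card E) \<le> beta_on V T" using le by simp
  then obtain B where B: "finite B" "B \<subseteq> V" "card B = card E"
    and Bind: "\<And>c b. (\<Sum>b\<in>B. c b *\<^sub>C b) \<in> bop_apply T ` V \<Longrightarrow> b \<in> B \<Longrightarrow> c b = 0"
    by (rule beta_on_ge_obtains_independent) blast
  obtain h where h: "bij_betw h E B" using finite_same_card_bij[OF E(1) B(1)] B(3) by auto
  obtain f where f: "\<And>e. e \<in> E \<Longrightarrow> cfunctional (f e)"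
    and dual: "\<And>d e. d \<in> E \<Longrightarrow> e \<in> E \<Longrightarrow> f d e = (if d = e then 1 else 0)"
    using exists_dual_family[OF E(1,3)] by blast
  define F where "F = (\<Sum>e\<in>E. rank_one (f e) (h e))"
  have F: "bop_apply F x = (\<Sum>e\<in>E. f e x *\<^sub>C h e)" for x
    unfolding F_def sum_bop_apply by (rule sum.cong) (simp_all add: rank_one_apply f)
  have hB: "h e \<in> B" if "e \<in> E" for e using h that by (auto simp: bij_betw_def)
  have EV: "E \<subseteq> V" and TE: "\<And>e. e \<in> E \<Longrightarrow> bop_apply T e = 0"
    using E(2) by (auto simp: null_space_on_def)
  have Bindep: "\<not> cdependent B"
    unfolding complex_vector.dependent_finite[OF B(1)]
  proof (clarify)
    fix u b assume u: "(\<Sum>v\<in>B. u v *\<^sub>C v) = 0" "b \<in> B" "u b \<noteq> 0"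
    have "0 \<in> bop_apply T ` V"
      using complex_vector.subspace_0[OF csubspace_image[OF V(1)]] .
    then show False using Bind[of u b] u by simp
  qed
  have FB: "bop_apply F x \<in> cspan B" for x
    unfolding F using hB by (intro complex_vector.span_sum complex_vector.span_scale complex_vector.span_base)
  have F0: "bop_apply F x = 0" if "\<And>e. e \<in> E \<Longrightarrow> f e x = 0" for x
    unfolding F by (rule sum.neutral) (simp add: that)
  have FE: "bop_apply F e = h e" if "e \<in> E" for e
  proof -
    have "bop_apply F e = (\<Sum>d\<in>E. if d = e then h d else 0)"
      unfolding F by (rule sum.cong) (use that in \<open>auto simp: dual scaleC_one\<close>)
    then show ?thesis using that E(1) by simp
  qed
  have S: "bop_apply (T + F) x = bop_apply T x + bop_apply F x" for x by (simp add: bop_rep_eq)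
  have inj: "null_space_on V (T + F) \<subseteq> {0}"
  proof
    fix x assume "x \<in> null_space_on V (T + F)"
    then have x: "x \<in> V" "bop_apply T x + bop_apply F x = 0" by (auto simp: null_space_on_def S)
    define g where "g = inv_into E h"
    have g: "g (h e) = e" if "e \<in> E" for e
      using h that unfolding g_def bij_betw_def by (simp add: inv_into_f_f)
    have "bop_apply F x = (\<Sum>e\<in>E. f (g (h e)) x *\<^sub>C h e)"
      unfolding F by (rule sum.cong) (simp_all add: g)
    also have "\<dots> = (\<Sum>b\<in>B. f (g b) x *\<^sub>C b)"
      by (rule sum.reindex_bij_betw[OF h])
    finally have "bop_apply F x = (\<Sum>b\<in>B. f (g b) x *\<^sub>C b)" .
    moreover have "bop_apply F x = bop_apply T (- x)"
      using x(2) by (simp add: bop_linear eq_neg_iff_add_eq_0 add.commute)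
    then have "bop_apply F x \<in> bop_apply T ` V"
      using complex_vector.subspace_neg[OF V(1) x(1)] by simp
    ultimately have "f (g b) x = 0" if "b \<in> B" for b
      using Bind[of "\<lambda>b. f (g b) x" b] that by simp
    then have fx: "f e x = 0" if "e \<in> E" for e using g[OF that] hB[OF that] by metis
    then have "bop_apply T x = 0" using x(2) F0[of x] by simp
    then have "x \<in> cspan E" using x(1) E(4) by (auto simp: null_space_on_def)
    then obtain u where u: "x = (\<Sum>e\<in>E. u e *\<^sub>C e)"
      using E(1) by (auto simp: complex_vector.span_finite)
    have "u d = 0" if d: "d \<in> E" for d
    proof -
      have "f d x = (\<Sum>e\<in>E. if d = e then u e else 0)"
        unfolding u cfunctionalD(6)[OF f[OF d]] cfunctionalD(2)[OF f[OF d]]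
        by (rule sum.cong) (use d in \<open>auto simp: dual\<close>)
      then show ?thesis using fx[OF d] d E(1) by simp
    qed
    then show "x \<in> {0}" unfolding u by simp
  qed
  have "bop_apply (T + F) ` V = cspan (bop_apply T ` V \<union> B)"
  proof
    show "bop_apply (T + F) ` V \<subseteq> cspan (bop_apply T ` V \<union> B)"
    proof clarify
      fix x assume "x \<in> V"
      then have "bop_apply T x \<in> cspan (bop_apply T ` V \<union> B)" by (intro complex_vector.span_base) auto
      moreover have "bop_apply F x \<in> cspan (bop_apply T ` V \<union> B)"
        using FB complex_vector.span_mono[of B "bop_apply T ` V \<union> B"] by blast
      ultimately show "bop_apply (T + F) x \<in> cspan (bop_apply T ` V \<union> B)"
        unfolding S by (rule complex_vector.span_add)
    qed
    show "cspan (bop_apply T ` V \<union> B) \<subseteq> bop_apply (T + F) ` V"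
    proof (rule complex_vector.span_minimal[OF _ csubspace_image[OF V(1)]], rule Un_least)
      show "bop_apply T ` V \<subseteq> bop_apply (T + F) ` V"
      proof clarify
        fix x assume x: "x \<in> V"
        define y where "y = x - (\<Sum>e\<in>E. f e x *\<^sub>C e)"
        have "y \<in> V" unfolding y_def using x EV V(1)
          by (intro complex_vector.subspace_diff complex_vector.subspace_sum complex_vector.subspace_scale) auto
        moreover have "bop_apply (T + F) y = bop_apply T x"
        proof -
          have "bop_apply T y = bop_apply T x" by (simp add: y_def bop_linear bop_apply_scaleC TE)
          moreover have "bop_apply F y = bop_apply F x - (\<Sum>e\<in>E. f e x *\<^sub>C h e)"
            by (simp add: y_def bop_linear bop_apply_scaleC FE)
          ultimately show ?thesis by (simp add: S F)
        qed
        ultimately show "bop_apply T x \<in> bop_apply (T + F) ` V" by (metis imageI)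
      qed
      show "B \<subseteq> bop_apply (T + F) ` V"
      proof
        fix b assume "b \<in> B"
        then obtain e where e: "e \<in> E" "b = h e" using h by (auto simp: bij_betw_def)
        then have "bop_apply (T + F) e = b" by (simp add: S TE FE)
        then show "b \<in> bop_apply (T + F) ` V" using e(1) EV by blast
      qed
    qed
  qed
  moreover have "cspan (bop_apply T ` V) = bop_apply T ` V"
    using csubspace_image[OF V(1)] by (simp only: complex_vector.span_eq_iff)
  then have "closed (cspan (bop_apply T ` V))" using cl by (simp only:)
  from closed_cspan_Un_finite[OF B(1) this] have "closed (cspan (bop_apply T ` V \<union> B))" .
  ultimately have "closed (bop_apply (T + F) ` V)" by (simp only:)
  then obtain c where "c > 0" "\<forall>x\<in>V. c * norm x \<le> norm (bop_apply (T + F) x)"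
    using lower_bound_of_closed_injective[OF V(1,2) inj] by blast
  then show ?thesis using that[OF E(1) EV B(1,2) Bindep B(3), of f F c] f dual FB F0 by blast
qed

text \<open>The operator \<open>S = T + F - \<nu>\<close> is still bounded below on \<open>V\<close>. As \<open>T - \<nu>\<close> differs from it by an operator
  with values in \<open>P = span B\<close>, both have the same preimage of \<open>P\<close> in \<open>V\<close>, of dimension at most
  \<open>dim P\<close> by injectivity of \<open>S\<close>; the counting argument applies. The range is closed because \<open>T - \<nu>\<close>
  agrees with \<open>S\<close> on a subspace \<open>K\<close> of finite codimension.\<close>

lemma nonpositive_index_stable:
  fixes T :: "'a::complex_banach bop" and n :: nat
  defines "V \<equiv> range (bop_apply (T ^ n))"
  assumes V: "closed V" and cl: "closed (bop_apply T ` V)"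
    and fin: "alpha_on V T < \<infinity>" and le: "alpha_on V T \<le> beta_on V T"
  shows "\<exists>\<epsilon>>0. \<forall>\<nu>. \<nu> \<noteq> 0 \<and> cmod \<nu> < \<epsilon> \<longrightarrow>
    upper_semi_fredholm (op_minus T \<nu>) \<and> alpha (op_minus T \<nu>) \<le> beta (op_minus T \<nu>)"
proof -
  have sV: "csubspace V" unfolding V_def by (rule csubspace_range)
  have TV: "bop_apply T ` V \<subseteq> V"
    unfolding V_def image_range_pow by (rule range_pow_antimono) simp
  obtain E B f F c where E: "finite E" "E \<subseteq> V"
    and B: "finite B" "B \<subseteq> V" "\<not> cdependent B" "card B = card E"
    and f': "\<forall>e\<in>E. cfunctional (f e)" and dual: "\<forall>d\<in>E. \<forall>e\<in>E. f d e = (if d = e then 1 else 0)"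
    and F: "\<forall>x. bop_apply F x \<in> cspan B" "\<forall>x. (\<forall>e\<in>E. f e x = 0) \<longrightarrow> bop_apply F x = 0"
    and c: "c > 0" "\<forall>x\<in>V. c * norm x \<le> norm (bop_apply (T + F) x)"
    by (rule finite_rank_correction[OF sV V TV cl fin le])
  have f: "cfunctional (f e)" if "e \<in> E" for e using f' that by blast
  define P where "P = cspan B"
  have P: "csubspace P" "P \<subseteq> V" "cdim_nat P = card B"
    unfolding P_def using complex_vector.span_minimal[OF B(2) sV]
      complex_vector.dim_span_eq_card_independent[OF B(3)] by auto
  define K where "K = {x \<in> V. \<forall>e\<in>E. f e x = 0}"
  have K: "csubspace K"
    using sV by (auto simp: K_def complex_vector.subspace_def cfunctionalD[OF f])
  have "closed K"
  proof -
    have "K = V \<inter> (\<Inter>e\<in>E. f e -` {0})" by (auto simp: K_def)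
    moreover have "closed (f e -` {0})" if "e \<in> E" for e
      by (rule closed_vimage[OF closed_singleton linear_continuous_on[OF cfunctionalD(1)[OF f[OF that]]]])
    ultimately show ?thesis using V by auto
  qed
  have main: "upper_semi_fredholm (op_minus T \<nu>) \<and> alpha (op_minus T \<nu>) \<le> beta (op_minus T \<nu>)"
    if \<nu>: "\<nu> \<noteq> 0" "cmod \<nu> < c / 2" for \<nu>
  proof -
    define U where "U = op_minus T \<nu>"
    define S where "S = op_minus (T + F) \<nu>"
    have US: "bop_apply U x = bop_apply S x - bop_apply F x" for x
      by (simp add: U_def S_def op_minus_apply bop_rep_eq)
    have Slow: "c / 2 * norm x \<le> norm (bop_apply S x)" if "x \<in> V" for x
      unfolding S_def using bspec[OF c(2) that] \<nu>(2) by (intro lower_bound_op_minus) auto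
    have c2: "c / 2 > 0" using c(1) by simp
    have "bop_apply U ` K = bop_apply S ` K"
      by (rule image_cong[OF refl]) (simp add: US F(2) K_def)
    moreover have "closed (bop_apply S ` K)"
      by (rule closed_image_of_lower_bound[OF K \<open>closed K\<close> c2], rule Slow) (simp add: K_def)
    moreover have "cspan (bop_apply U ` K) = bop_apply U ` K"
      using csubspace_image[OF K] by (simp only: complex_vector.span_eq_iff)
    ultimately have "closed (cspan (bop_apply U ` K))" by (simp only:)
    from closed_cspan_Un_finite[OF finite_imageI[OF E(1), of "bop_apply U"] this]
    have "closed (cspan (bop_apply U ` K \<union> bop_apply U ` E))" .
    moreover have "bop_apply U ` V = cspan (bop_apply U ` K \<union> bop_apply U ` E)"
    proof
      show "bop_apply U ` V \<subseteq> cspan (bop_apply U ` K \<union> bop_apply U ` E)"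
      proof clarify
        fix x assume x: "x \<in> V"
        define y where "y = x - (\<Sum>e\<in>E. f e x *\<^sub>C e)"
        have yV: "y \<in> V" unfolding y_def using x E(2) sV
          by (intro complex_vector.subspace_diff complex_vector.subspace_sum complex_vector.subspace_scale) auto
        have "f d y = 0" if d: "d \<in> E" for d
        proof -
          have "(\<Sum>e\<in>E. f e x * f d e) = (\<Sum>e\<in>E. if d = e then f e x else 0)"
            by (rule sum.cong) (use d in \<open>auto simp: dual\<close>)
          then show ?thesis
            using d E(1) by (simp add: y_def cfunctionalD[OF f[OF d]])
        qed
        then have "bop_apply U y \<in> cspan (bop_apply U ` K \<union> bop_apply U ` E)"
          using yV by (intro complex_vector.span_base) (auto simp: K_def)
        moreover have "(\<Sum>e\<in>E. f e x *\<^sub>C bop_apply U e) \<in> cspan (bop_apply U ` K \<union> bop_apply U ` E)"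
          by (intro complex_vector.span_sum complex_vector.span_scale complex_vector.span_base) auto
        ultimately have "bop_apply U y + (\<Sum>e\<in>E. f e x *\<^sub>C bop_apply U e)
            \<in> cspan (bop_apply U ` K \<union> bop_apply U ` E)" by (rule complex_vector.span_add)
        then show "bop_apply U x \<in> cspan (bop_apply U ` K \<union> bop_apply U ` E)"
          by (simp add: y_def bop_linear bop_apply_scaleC)
      qed
      show "cspan (bop_apply U ` K \<union> bop_apply U ` E) \<subseteq> bop_apply U ` V"
        by (rule complex_vector.span_minimal[OF _ csubspace_image[OF sV]]) (use E(2) in \<open>auto simp: K_def\<close>)
    qed
    ultimately have "closed (bop_apply U ` V)" by (simp only:)
    then have clU: "closed (range (bop_apply U))"
      unfolding U_def V_def by (rule closed_range_op_minus[OF \<nu>(1)])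
    have "null_space_on V S \<subseteq> cspan {}"
      using null_space_of_lower_bound[OF c2 Slow] by simp
    then obtain H where H: "finite H" "card H \<le> card B" "{x \<in> V. bop_apply S x \<in> P} \<subseteq> cspan H"
      using findim_preimage[OF sV finite.emptyI _ B(1), of S P] by (auto simp: P_def)
    \<comment> \<open>Since \<open>P \<subseteq> V\<close> and \<open>\<nu> \<noteq> 0\<close>, the preimage of \<open>P\<close> in the whole space already lies in \<open>V\<close>.\<close>
    have "{x \<in> UNIV. bop_apply U x \<in> P} \<subseteq> cspan H"
    proof
      fix x assume "x \<in> {x \<in> UNIV. bop_apply U x \<in> P}"
      then have x: "bop_apply U x \<in> P" by simp
      then have "bop_apply (op_minus T \<nu>) x \<in> range (bop_apply (T ^ n))"
        using P(2) by (auto simp: U_def V_def)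
      then have "x \<in> V" unfolding V_def by (rule preimage_op_minus_range_pow[OF \<nu>(1)])
      moreover have "bop_apply S x = bop_apply U x + bop_apply F x" by (simp add: US)
      then have "bop_apply S x \<in> P"
        using complex_vector.subspace_add[OF P(1) x] F(1)[rule_format, of x] by (simp add: P_def)
      ultimately show "x \<in> cspan H" using H(3) by blast
    qed
    then have "alpha U < \<infinity> \<and> alpha U \<le> beta U"
      using H(1,2) P(3) B(1)
      by (intro alpha_le_beta_of_small_preimage[OF complex_vector.subspace_UNIV P(1) subset_UNIV B(1)]) (auto simp: P_def)
    then show ?thesis using clU unfolding upper_semi_fredholm_on_def U_def by blast
  qed
  then show ?thesis using c(1) by (intro exI[of _ "c / 2"]) auto
qed

section \<open>Eigenvalues near a point of infinite ascent\<close>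

lemma csubspace_eq_of_dim_le:
  assumes "csubspace A" "A \<subseteq> B" "B \<subseteq> cspan F" "finite F" "cdim_nat B \<le> cdim_nat A"
  shows "A = B"
proof -
  obtain E where E: "E \<subseteq> A" "\<not> cdependent E" "A \<subseteq> cspan E" "card E = cdim_nat A"
    using complex_vector.basis_exists[of A] by blast
  obtain G where G: "E \<subseteq> G" "G \<subseteq> B" "\<not> cdependent G" "B \<subseteq> cspan G"
    using complex_vector.maximal_independent_subset_extend[OF subset_trans[OF E(1) assms(2)] E(2)] by blast
  have Gf: "finite G"
    using complex_vector.independent_span_bound[OF assms(4) G(3) subset_trans[OF G(2) assms(3)]] by auto
  have "card G = cdim_nat B" by (rule complex_vector.basis_card_eq_dim[OF G(2,4,3)])
  then have "card G \<le> card E" using E(4) assms(5) by simp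
  then have "E = G" by (rule card_seteq[OF Gf G(1)])
  then have "B \<subseteq> cspan E" using G(4) by simp
  then show ?thesis using complex_vector.span_minimal[OF E(1) assms(1)] assms(2) by blast
qed

text \<open>Choose \<open>x 0 = e\<close> and \<open>x (Suc k) \<in> M\<close> with \<open>T (x (Suc k)) = x k\<close> and \<open>norm (x k) \<le> C ^ k * norm e\<close>. Then
  \<open>\<Sum>k. \<nu> ^ k x k\<close> is an eigenvector for \<open>\<nu>\<close>, nonzero because the terms after \<open>x 0 = e\<close> add up to at most half the norm of \<open>e\<close>.\<close>

lemma surjective_noninjective_eigenvalues:
  fixes T :: "'a::complex_banach bop"
  assumes M: "csubspace M" "closed M" and TM: "bop_apply T ` M = M"
    and e: "e \<in> M" "e \<noteq> 0" "bop_apply T e = 0"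
  shows "\<exists>\<epsilon>>0. \<forall>\<nu>. cmod \<nu> < \<epsilon> \<longrightarrow> null_space (op_minus T \<nu>) \<noteq> {0}"
proof -
  obtain C where C: "C > 0" "\<forall>y\<in>bop_apply T ` M. \<exists>x\<in>M. bop_apply T x = y \<and> norm x \<le> C * norm y"
    using closed_image_imp_bounded_preimages[OF bounded_linear_bop_apply csubspace_imp_subspace[OF M(1)] M(2), of T]
      TM M(2) by auto
  have "\<forall>y\<in>M. \<exists>x. x \<in> M \<and> bop_apply T x = y \<and> norm x \<le> C * norm y"
    using C(2) unfolding TM Bex_def .
  from bchoice[OF this] obtain g
    where g: "\<And>y. y \<in> M \<Longrightarrow> g y \<in> M \<and> bop_apply T (g y) = y \<and> norm (g y) \<le> C * norm y"
    by blast
  define x where "x k = (g ^^ k) e" for k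
  have x0: "x 0 = e" and xS: "x (Suc k) = g (x k)" for k by (simp_all add: x_def)
  have xM: "x k \<in> M" for k by (induction k) (simp_all add: x0 xS e(1) g)
  have xn: "norm (x k) \<le> C ^ k * norm e" for k
  proof (induction k)
    case (Suc k)
    have "norm (x (Suc k)) \<le> C * norm (x k)" using g[OF xM] by (simp add: xS)
    also have "\<dots> \<le> C * (C ^ k * norm e)" using Suc C(1) by (intro mult_left_mono) auto
    finally show ?case by (simp add: mult.assoc)
  qed (simp add: x0)
  have "null_space (op_minus T \<nu>) \<noteq> {0}" if \<nu>: "cmod \<nu> < 1 / (3 * C)" for \<nu>
  proof -
    define u where "u k = \<nu> ^ k *\<^sub>C x k" for k
    have q: "cmod \<nu> * C \<le> 1/3" using \<nu> C(1) by (simp add: field_simps)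
    have un: "norm (u k) \<le> norm e * (1/3) ^ k" for k
    proof -
      have "norm (u k) \<le> cmod \<nu> ^ k * (C ^ k * norm e)"
        unfolding u_def norm_scaleC norm_power by (intro mult_left_mono xn) simp
      also have "\<dots> = (cmod \<nu> * C) ^ k * norm e" by (simp add: power_mult_distrib)
      also have "\<dots> \<le> (1/3) ^ k * norm e"
        using q C(1) by (intro mult_right_mono power_mono) auto
      finally show ?thesis by (simp add: mult.commute)
    qed
    have geo: "summable (\<lambda>k. norm e * (1/3::real) ^ k)"
      by (intro summable_mult summable_geometric) simp
    have su: "summable u"
      by (rule summable_comparison_test'[OF geo]) (use un in auto)
    define z where "z = suminf u"
    have zsums: "u sums z" unfolding z_def by (rule summable_sums[OF su])
    have split: "(\<lambda>k. u (Suc k)) sums (z - e)"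
      using zsums by (subst sums_Suc_iff) (simp add: u_def x0 scaleC_one)
    have "norm (z - e) \<le> norm e / 2"
    proof -
      have "(\<lambda>k. norm e * (1/3::real) ^ Suc k) sums (norm e / 2)"
        using sums_mult[OF geometric_sums[of "1/3::real"], of "norm e / 3"] by simp
      then show ?thesis
        using norm_suminf_le[of "\<lambda>k. u (Suc k)" "\<lambda>k. norm e * (1/3::real) ^ Suc k"] un split
        by (simp add: sums_iff del: power_Suc)
    qed
    then have "z \<noteq> 0" using e(2) by auto
    have Tu: "bop_apply T (u (Suc k)) = \<nu> *\<^sub>C u k" for k
      using g[OF xM] by (simp add: u_def bop_apply_scaleC xS scaleC_scaleC)
    have "(\<lambda>k. bop_apply T (u (Suc k))) sums bop_apply T (z - e)"
      by (rule bounded_linear.sums[OF bounded_linear_bop_apply split])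
    moreover have "(\<lambda>k. \<nu> *\<^sub>C u k) sums (\<nu> *\<^sub>C z)"
      by (rule bounded_linear.sums[OF bounded_linear_scaleC zsums])
    ultimately have "bop_apply T (z - e) = \<nu> *\<^sub>C z" by (simp add: Tu sums_unique2)
    then have "bop_apply T z = \<nu> *\<^sub>C z" by (simp add: bop_linear e(3))
    then have "z \<in> null_space (op_minus T \<nu>)" by (simp add: null_space_on_def op_minus_apply)
    then show ?thesis using \<open>z \<noteq> 0\<close> by blast
  qed
  then show ?thesis using C(1) by (intro exI[of _ "1 / (3 * C)"]) auto
qed

text \<open>The spaces \<open>N (T) \<inter> R (T\<^sup>k)\<close> for \<open>k \<ge> n\<close> are finite-dimensional and decrease, so they are constant
  from some \<open>m\<close> on. If the constant value is zero, the ascent is finite. Otherwise it lies in the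
  intersection \<open>M\<close> of the ranges. The map \<open>T\<close> sends \<open>M\<close> onto \<open>M\<close>: two preimages of a point of \<open>M\<close>, taken in
  \<open>R (T\<^sup>m)\<close> and \<open>R (T\<^sup>k)\<close>, differ by an element of the constant space, so the first one lies in every
  \<open>R (T\<^sup>k)\<close>.\<close>

lemma finite_ascent_or_eigenvalues:
  fixes T :: "'a::complex_banach bop"
  assumes "upper_semi_b_fredholm_at T n"
  shows "(\<exists>m. null_space (T ^ m) = null_space (T ^ Suc m) \<and> closed (range (bop_apply (T ^ Suc m)))) \<or>
    (\<exists>\<epsilon>>0. \<forall>\<nu>. cmod \<nu> < \<epsilon> \<longrightarrow> null_space (op_minus T \<nu>) \<noteq> {0})"
proof -
  define V where "V = range (bop_apply (T ^ n))"
  have V: "csubspace V" unfolding V_def by (rule csubspace_range)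
  have clV: "closed V" "closed (bop_apply T ` V)" and fin: "alpha_on V T < \<infinity>"
    using assms unfolding upper_semi_b_fredholm_at_def upper_semi_fredholm_on_def V_def by auto
  obtain F where F: "finite F" "null_space_on V T \<subseteq> cspan F"
    using fin[unfolded alpha_on_def cdim_finite_iff] by blast
  have RV: "range (bop_apply (T ^ k)) \<subseteq> V" if "n \<le> k" for k
    unfolding V_def by (rule range_pow_antimono[OF that])
  have cl: "closed (range (bop_apply (T ^ k)))" if "n \<le> k" for k
    using that
  proof (induction k rule: dec_induct)
    case base
    then show ?case using clV(1) by (simp add: V_def)
  next
    case (step k)
    have "closed {u + z | u z. u \<in> range (bop_apply (T ^ k)) \<and> z \<in> null_space_on V T}"
      by (rule closed_csubspace_plus_finite[OF csubspace_range step.IH csubspace_null_space_on[OF V] F(2,1)])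
    then have "closed (bop_apply T ` range (bop_apply (T ^ k)))"
      by (intro closed_image_of_subspace[OF bounded_linear_bop_apply csubspace_imp_subspace[OF V] clV RV[OF step(1)]])
        (simp add: null_space_on_def)
    then show ?case by (simp only: image_range_pow)
  qed
  define N where "N k = null_space T \<inter> range (bop_apply (T ^ k))" for k
  have N: "csubspace (N k)" for k
    unfolding N_def by (intro complex_vector.subspace_inter csubspace_null_space_on csubspace_range) simp
  have NF: "N k \<subseteq> cspan F" if "n \<le> k" for k
    using F(2) RV[OF that] by (auto simp: N_def null_space_on_def)
  have Nmono: "N k \<subseteq> N m" if "m \<le> k" for m k
    using range_pow_antimono[OF that, of T] by (auto simp: N_def)
  obtain m where m: "n \<le> m" and min: "\<And>k. n \<le> k \<Longrightarrow> cdim_nat (N m) \<le> cdim_nat (N k)"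
    using ex_has_least_nat[of "\<lambda>k. n \<le> k" n "\<lambda>k. cdim_nat (N k)"] by auto
  have Nm: "N k = N m" if "m \<le> k" for k
    by (rule csubspace_eq_of_dim_le[OF N Nmono[OF that] NF[OF m] F(1)]) (use m that in \<open>intro min, simp\<close>)
  show ?thesis
  proof (cases "N m \<subseteq> {0}")
    case True
    then have "null_space (T ^ m) = null_space (T ^ Suc m)"
      by (simp only: null_space_pow_stable_iff N_def)
    moreover have "closed (range (bop_apply (T ^ Suc m)))" using cl[of "Suc m"] m by simp
    ultimately show ?thesis by blast
  next
    case False
    then obtain e where e: "e \<in> N m" "e \<noteq> 0" by blast
    define M where "M = (\<Inter>k\<in>{m..}. range (bop_apply (T ^ k)))"
    have M: "csubspace M" unfolding M_def
      by (rule complex_vector.subspace_Inter) (auto intro: csubspace_range)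
    have clM: "closed M" unfolding M_def using cl m by (intro closed_INT) auto
    have "e \<in> M" unfolding M_def
    proof
      fix k assume "k \<in> {m..}"
      then have "e \<in> N k" using Nm[of k] e(1) by simp
      then show "e \<in> range (bop_apply (T ^ k))" by (simp add: N_def)
    qed
    have TM: "bop_apply T ` M = M"
    proof
      show "bop_apply T ` M \<subseteq> M"
      proof (clarsimp simp: M_def)
        fix x k assume x: "\<forall>k\<in>{m..}. x \<in> range (bop_apply (T ^ k))" "m \<le> k"
        then have "x \<in> range (bop_apply (T ^ k))" by simp
        then have "bop_apply T x \<in> range (bop_apply (T ^ Suc k))"
          unfolding image_range_pow[symmetric] by (rule imageI)
        then show "bop_apply T x \<in> range (bop_apply (T ^ k))"
          using range_pow_antimono[of k "Suc k" T] by auto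
      qed
      show "M \<subseteq> bop_apply T ` M"
      proof
        fix y assume y: "y \<in> M"
        have pre: "\<exists>x\<in>range (bop_apply (T ^ k)). bop_apply T x = y" if "m \<le> k" for k
        proof -
          have "y \<in> range (bop_apply (T ^ Suc k))" using y that by (auto simp: M_def simp del: power_Suc)
          then show ?thesis unfolding image_range_pow[symmetric] by auto
        qed
        obtain x where x: "x \<in> range (bop_apply (T ^ m))" "bop_apply T x = y" using pre[of m] by auto
        have "x \<in> M" unfolding M_def
        proof
          fix k assume "k \<in> {m..}"
          then have k: "m \<le> k" by simp
          obtain x' where x': "x' \<in> range (bop_apply (T ^ k))" "bop_apply T x' = y" using pre[OF k] by auto
          have "x' \<in> range (bop_apply (T ^ m))" using x'(1) range_pow_antimono[OF k, of T] by blast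
          then have "x - x' \<in> N m"
            using x x' complex_vector.subspace_diff[OF csubspace_range[of "T ^ m"]]
            by (simp add: N_def null_space_on_def bop_linear)
          then have "x - x' \<in> N k" using Nm[OF k] by simp
          then have "x - x' \<in> range (bop_apply (T ^ k))" by (simp add: N_def)
          from complex_vector.subspace_add[OF csubspace_range this x'(1)]
          show "x \<in> range (bop_apply (T ^ k))" by simp
        qed
        then show "y \<in> bop_apply T ` M" using x(2) by blast
      qed
    qed
    have "bop_apply T e = 0" using e(1) by (simp add: N_def null_space_on_def)
    then show ?thesis
      by (intro disjI2 surjective_noninjective_eigenvalues[OF M clM TM \<open>e \<in> M\<close> e(2)])
  qed
qed

section \<open>Left Drazin invertible operators\<close>

lemma ascent_eq_enatD: "ascent T = enat a \<Longrightarrow> null_space (T ^ a) = null_space (T ^ Suc a)"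
  unfolding ascent_def by (metis (mono_tags, lifting) LeastI_ex enat.distinct(1) enat.inject)

lemma ascent_le:
  assumes "null_space (T ^ m) = null_space (T ^ Suc m)"
  obtains a where "a \<le> m" "ascent T = enat a"
proof
  show "(LEAST n. null_space (T ^ n) = null_space (T ^ Suc n)) \<le> m"
    using assms by (rule Least_le)
  show "ascent T = enat (LEAST n. null_space (T ^ n) = null_space (T ^ Suc n))"
    unfolding ascent_def using assms by (auto simp del: power_Suc)
qed

text \<open>The usual definition asks for a finite ascent \<open>a\<close> and a closed range of \<open>T ^ Suc a\<close>. Any exponent
  \<open>n \<ge> a\<close> may serve instead, since closedness descends to \<open>a\<close>.\<close>

definition left_drazin :: "'a::complex_normed_vector bop \<Rightarrow> bool"
  where "left_drazin T \<longleftrightarrow>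
    (\<exists>n. null_space (T ^ n) = null_space (T ^ Suc n) \<and> closed (range (bop_apply (T ^ Suc n))))"

lemma op_minus_op_minus: "op_minus (op_minus T \<mu>) \<nu> = op_minus T (\<mu> + \<nu>)"
  by (rule bop_eqI) (simp add: op_minus_apply scaleC_add_left)

lemma null_space_on_0: "csubspace V \<Longrightarrow> 0 \<in> null_space_on V T"
  using csubspace_null_space_on complex_vector.subspace_0 by blast

lemma bounded_belowI:
  fixes T :: "'a::complex_banach bop"
  assumes "c > 0" "\<And>x. c * norm x \<le> norm (bop_apply T x)"
  shows "bounded_below T"
  unfolding bounded_below_def
  using closed_image_of_lower_bound[of UNIV c T] null_space_of_lower_bound[of c UNIV T]
    null_space_on_0[of UNIV T] assms by auto

lemma bounded_belowE:
  fixes T :: "'a::complex_banach bop"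
  assumes "bounded_below T"
  obtains c where "c > 0" "\<And>x. c * norm x \<le> norm (bop_apply T x)"
  using lower_bound_of_closed_injective[of UNIV T] assms unfolding bounded_below_def by auto

lemma bounded_below_imp_left_drazin:
  assumes "bounded_below T"
  shows "left_drazin T"
proof -
  have "null_space (T ^ 0) = null_space (T ^ Suc 0)"
    unfolding null_space_pow_stable_iff using assms by (auto simp: bounded_below_def)
  then show ?thesis
    using assms unfolding left_drazin_def by (intro exI[of _ 0]) (simp add: bounded_below_def)
qed

text \<open>On the closed space \<open>R (T\<^sup>n)\<close> the operator is injective with closed range, hence bounded below, and
  stays so under small perturbations; for \<open>\<nu> \<noteq> 0\<close> this passes to the whole space.\<close>

lemma left_drazin_punctured:
  fixes T :: "'a::complex_banach bop"
  assumes "left_drazin T"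
  shows "\<exists>\<epsilon>>0. \<forall>\<nu>. \<nu> \<noteq> 0 \<and> cmod \<nu> < \<epsilon> \<longrightarrow> bounded_below (op_minus T \<nu>)"
proof -
  obtain n where n: "null_space (T ^ n) = null_space (T ^ Suc n)" "closed (range (bop_apply (T ^ Suc n)))"
    using assms unfolding left_drazin_def by blast
  define V where "V = range (bop_apply (T ^ n))"
  have V: "csubspace V" "closed V"
    unfolding V_def using closed_range_pow_below[OF n(1) order_refl _ n(2)] by (auto intro: csubspace_range)
  have inj: "null_space_on V T \<subseteq> {0}"
    using n(1) unfolding null_space_pow_stable_iff V_def by (auto simp: null_space_on_def)
  have cl: "closed (bop_apply T ` V)" unfolding V_def image_range_pow by (rule n(2))
  obtain c where c: "c > 0" "\<forall>x\<in>V. c * norm x \<le> norm (bop_apply T x)"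
    using lower_bound_of_closed_injective[OF V inj cl] by blast
  have "bounded_below (op_minus T \<nu>)" if \<nu>: "\<nu> \<noteq> 0" "cmod \<nu> < c / 2" for \<nu>
  proof -
    have c2: "c / 2 > 0" using c(1) by simp
    have low: "c / 2 * norm x \<le> norm (bop_apply (op_minus T \<nu>) x)" if "x \<in> V" for x
      using bspec[OF c(2) that] \<nu>(2) by (intro lower_bound_op_minus) auto
    have "closed (bop_apply (op_minus T \<nu>) ` V)"
      by (rule closed_image_of_lower_bound[OF V c2 low])
    then have "closed (range (bop_apply (op_minus T \<nu>)))"
      unfolding V_def by (rule closed_range_op_minus[OF \<nu>(1)])
    moreover have "null_space (op_minus T \<nu>) \<subseteq> {0}"
    proof
      fix x assume x: "x \<in> null_space (op_minus T \<nu>)"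
      then have "bop_apply (op_minus T \<nu>) x \<in> range (bop_apply (T ^ n))"
        using complex_vector.subspace_0[OF csubspace_range[of "T ^ n"]] by (simp add: null_space_on_def)
      then have "x \<in> V" unfolding V_def by (rule preimage_op_minus_range_pow[OF \<nu>(1)])
      then show "x \<in> {0}"
        using null_space_of_lower_bound[OF c2 low] x by (auto simp: null_space_on_def)
    qed
    ultimately show ?thesis
      using null_space_on_0[of UNIV "op_minus T \<nu>"] by (auto simp: bounded_below_def)
  qed
  then show ?thesis using c(1) by (intro exI[of _ "c / 2"]) auto
qed

lemma Pi_a_iff:
  fixes A :: "'a::complex_banach bop"
  shows "\<mu> \<in> Pi_a A \<longleftrightarrow> \<mu> \<in> sigma_a A \<and> left_drazin (op_minus A \<mu>)"
proof
  assume "\<mu> \<in> Pi_a A"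
  then show "\<mu> \<in> sigma_a A \<and> left_drazin (op_minus A \<mu>)"
    using ascent_eq_enatD[of "op_minus A \<mu>"]
    by (auto simp: Pi_a_def isolated_points_def isolated_in_def left_drazin_def simp del: power_Suc)
next
  assume \<mu>: "\<mu> \<in> sigma_a A \<and> left_drazin (op_minus A \<mu>)"
  define T where "T = op_minus A \<mu>"
  obtain n where n: "null_space (T ^ n) = null_space (T ^ Suc n)" "closed (range (bop_apply (T ^ Suc n)))"
    using \<mu> unfolding left_drazin_def T_def by blast
  obtain a where a: "a \<le> n" "ascent T = enat a" using n(1) by (rule ascent_le)
  have "closed (range (bop_apply (T ^ Suc a)))"
    using closed_range_pow_below[OF ascent_eq_enatD[OF a(2)], of "Suc a" "Suc n"] a(1) n(2) by simp
  moreover have "\<mu> \<in> isolated_points (sigma_a A)"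
  proof -
    obtain \<epsilon> where \<epsilon>: "\<epsilon> > 0" "\<And>\<nu>. \<nu> \<noteq> 0 \<Longrightarrow> cmod \<nu> < \<epsilon> \<Longrightarrow> bounded_below (op_minus T \<nu>)"
      using left_drazin_punctured[of T] \<mu> unfolding T_def by blast
    have "\<nu> = \<mu>" if "\<nu> \<in> ball \<mu> \<epsilon>" "\<nu> \<in> sigma_a A" for \<nu>
    proof (rule ccontr)
      assume "\<nu> \<noteq> \<mu>"
      then have "bounded_below (op_minus T (\<nu> - \<mu>))"
        using that(1) by (intro \<epsilon>(2)) (auto simp: dist_norm norm_minus_commute)
      then show False using that(2) by (simp add: T_def op_minus_op_minus sigma_a_def)
    qed
    then have "ball \<mu> \<epsilon> \<inter> sigma_a A = {\<mu>}" using \<mu> \<epsilon>(1) by auto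
    then show ?thesis
      using \<mu> unfolding isolated_points_def isolated_in_def by blast
  qed
  ultimately show "\<mu> \<in> Pi_a A" using a(2) by (simp add: Pi_a_def T_def)
qed

text \<open>The B-Fredholm index is computed at the least admissible exponent \<open>m\<close>, which can be smaller than the
  ascent; there \<open>T\<close> has a null space that may be nonzero, but its finite ascent bounds the index.\<close>

lemma left_drazin_imp_b_fredholm:
  fixes T :: "'a::complex_banach bop"
  assumes "left_drazin T"
  shows "upper_semi_b_fredholm T \<and> \<not> 0 < b_fredholm_index T"
proof -
  obtain n where n: "null_space (T ^ n) = null_space (T ^ Suc n)" "closed (range (bop_apply (T ^ Suc n)))"
    using assms unfolding left_drazin_def by blast
  have "null_space_on (range (bop_apply (T ^ n))) T \<subseteq> cspan {}"
    using n(1) unfolding null_space_pow_stable_iff by (auto simp: null_space_on_def)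
  then have "alpha_on (range (bop_apply (T ^ n))) T < \<infinity>"
    unfolding alpha_on_def cdim_finite_iff by blast
  then have at: "upper_semi_b_fredholm_at T n"
    using closed_range_pow_below[OF n(1) order_refl _ n(2)] n(2)
    by (simp add: upper_semi_b_fredholm_at_def upper_semi_fredholm_on_def image_range_pow)
  define m where "m = (LEAST n. upper_semi_b_fredholm_at T n)"
  define V where "V = range (bop_apply (T ^ m))"
  have "upper_semi_b_fredholm_at T m" unfolding m_def by (rule LeastI[of "upper_semi_b_fredholm_at T", OF at])
  then have fin: "alpha_on V T < \<infinity>"
    by (simp add: upper_semi_b_fredholm_at_def upper_semi_fredholm_on_def V_def)
  have "csubspace V" unfolding V_def by (rule csubspace_range)
  moreover have "bop_apply T ` V \<subseteq> V"
    unfolding V_def image_range_pow by (rule range_pow_antimono) simp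
  ultimately have "alpha_on V T \<le> beta_on V T"
    using fin n(1)[symmetric] by (rule alpha_le_beta_of_finite_ascent)
  then show ?thesis
    using at index_on_pos_iff[OF fin]
    by (auto simp: upper_semi_b_fredholm_def b_fredholm_index_def m_def V_def)
qed

lemma sigma_SBF_subset:
  fixes A :: "'a::complex_banach bop"
  shows "sigma_SBF A \<subseteq> sigma_a A - Pi_a A"
  using left_drazin_imp_b_fredholm bounded_below_imp_left_drazin
  by (auto simp: sigma_SBF_def Pi_a_iff sigma_a_def)

lemma Pi_a_or_eigenvalues:
  fixes A :: "'a::complex_banach bop"
  assumes "\<mu> \<in> sigma_a A" "\<mu> \<notin> sigma_SBF A"
  shows "\<mu> \<in> Pi_a A \<or> (\<exists>\<epsilon>>0. \<forall>\<nu>. cmod \<nu> < \<epsilon> \<longrightarrow> \<mu> + \<nu> \<in> sigma_a A)"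
proof -
  obtain n where "upper_semi_b_fredholm_at (op_minus A \<mu>) n"
    using assms(2) by (auto simp: sigma_SBF_def upper_semi_b_fredholm_def)
  from finite_ascent_or_eigenvalues[OF this] show ?thesis
    using assms(1) unfolding Pi_a_iff left_drazin_def[symmetric] op_minus_op_minus
    by (auto simp: sigma_a_def bounded_below_def)
qed

lemma not_isolated_if_nhd:
  assumes "\<epsilon> > 0" "\<And>\<nu>. cmod \<nu> < \<epsilon> \<Longrightarrow> \<mu> + \<nu> \<in> S"
  shows "\<mu> \<notin> isolated_points S"
proof
  assume "\<mu> \<in> isolated_points S"
  then obtain U where U: "open U" "U \<inter> S = {\<mu>}" by (auto simp: isolated_points_def isolated_in_def)
  then have "\<mu> \<in> U" by blast
  then obtain d where d: "d > 0" "ball \<mu> d \<subseteq> U" using U(1) open_contains_ball by blast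
  define \<nu> where "\<nu> = complex_of_real (min d \<epsilon> / 2)"
  have \<nu>: "\<nu> \<noteq> 0" "cmod \<nu> < d" "cmod \<nu> < \<epsilon>"
    using d(1) assms(1) by (auto simp: \<nu>_def norm_divide)
  then have "\<mu> + \<nu> \<in> U \<inter> S" using d(2) assms(2) by (auto simp: dist_norm)
  then show False using U(2) \<nu>(1) by simp
qed

lemma alpha_eq_0_iff: "alpha T = 0 \<longleftrightarrow> null_space T = {0}"
proof
  assume *: "alpha T = 0"
  then obtain F where F: "finite F" "null_space T \<subseteq> cspan F"
    unfolding alpha_on_def using cdim_finite_iff[of "null_space T"] by auto
  obtain B where B: "finite B" "null_space T \<subseteq> cspan B" "card B = cdim_nat (null_space T)"
    using findim_basis[OF F(2,1)] by metis
  have "card B = 0" using * B F by (auto simp: alpha_on_def cdim_def zero_enat_def split: if_splits)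
  then show "null_space T = {0}" using B null_space_on_0[of UNIV T] by auto
next
  assume *: "null_space T = {0}"
  have "cdim_nat ({0} :: 'a set) \<le> card ({} :: 'a set)"
    by (rule complex_vector.dim_le_card) auto
  moreover have "\<exists>B. finite B \<and> {0 :: 'a} \<subseteq> cspan B" by (intro exI[of _ "{}"]) simp
  ultimately show "alpha T = 0" unfolding alpha_on_def * cdim_def by (auto simp: zero_enat_def)
qed

text \<open>If \<open>alpha\<close> were zero, closedness of the range of a power would descend to the range of the operator itself,
  which would then be bounded below.\<close>

lemma Pi_a_subset_E_a:
  fixes A :: "'a::complex_banach bop"
  shows "Pi_a A \<subseteq> E_a A"
proof
  fix \<mu> assume \<mu>: "\<mu> \<in> Pi_a A"
  define T where "T = op_minus A \<mu>"
  obtain n where n: "closed (range (bop_apply (T ^ Suc n)))"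
    using \<mu> unfolding Pi_a_iff left_drazin_def T_def by blast
  have "alpha T \<noteq> 0"
  proof
    assume 0: "alpha T = 0"
    then have "closed (range (bop_apply T))" by (intro closed_range_of_closed_range_pow[OF _ n]) simp
    with 0 have "bounded_below T" by (simp add: bounded_below_def alpha_eq_0_iff)
    then show False using \<mu> by (simp add: Pi_a_iff sigma_a_def T_def)
  qed
  then show "\<mu> \<in> E_a A" using \<mu> by (auto simp: E_a_def Pi_a_def T_def zero_less_iff_neq_zero)
qed

section \<open>Browder and Weyl type theorems\<close>

text \<open>A point of \<open>E_a A\<close> is isolated in \<open>sigma_a A\<close> and, by assumption, is not in \<open>sigma_SBF A\<close>; isolation
  excludes the alternative of eigenvalues nearby.\<close>

lemma generalized_a_weyl_imp_E_a_eq: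
  fixes A :: "'a::complex_banach bop"
  assumes "generalized_a_weyl A"
  shows "E_a A = Pi_a A"
proof (rule antisym[OF _ Pi_a_subset_E_a], rule subsetI)
  fix \<mu> assume \<mu>: "\<mu> \<in> E_a A"
  then have iso: "\<mu> \<in> isolated_points (sigma_a A)" by (simp add: E_a_def)
  then have "\<mu> \<in> sigma_a A" by (simp add: isolated_points_def isolated_in_def)
  moreover have "\<mu> \<notin> sigma_SBF A" using \<mu> assms by (simp add: generalized_a_weyl_def)
  ultimately show "\<mu> \<in> Pi_a A"
    using Pi_a_or_eigenvalues[of \<mu> A] not_isolated_if_nhd[of _ \<mu> "sigma_a A"] iso by blast
qed

lemma sigma_aw_subset:
  fixes A :: "'a::complex_banach bop"
  shows "sigma_aw A \<subseteq> sigma_a A - Pi_a0 A"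
proof
  fix \<mu> assume \<mu>: "\<mu> \<in> sigma_aw A"
  define T where "T = op_minus A \<mu>"
  have "\<mu> \<notin> Pi_a0 A"
  proof
    assume "\<mu> \<in> Pi_a0 A"
    then have fin: "alpha T < \<infinity>" and "left_drazin T" by (auto simp: Pi_a0_def Pi_a_iff T_def)
    then obtain n where n: "null_space (T ^ n) = null_space (T ^ Suc n)" "closed (range (bop_apply (T ^ Suc n)))"
      unfolding left_drazin_def by blast
    have "upper_semi_fredholm T"
      using fin closed_range_of_closed_range_pow[OF fin n(2)] by (simp add: upper_semi_fredholm_on_def)
    moreover have "alpha T \<le> beta T"
      by (rule alpha_le_beta_of_finite_ascent[OF _ _ fin n(1)[symmetric]]) auto
    ultimately show False using \<mu> index_on_pos_iff[OF fin] by (auto simp: sigma_aw_def T_def)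
  qed
  then show "\<mu> \<in> sigma_a A - Pi_a0 A" using \<mu> by (simp add: sigma_aw_def)
qed

text \<open>A semi-Fredholm operator is semi B-Fredholm at exponent \<open>0\<close>, where the two indices agree.\<close>

lemma sigma_SBF_subset_sigma_aw:
  fixes A :: "'a::complex_banach bop"
  assumes \<mu>: "\<mu> \<in> sigma_SBF A"
  shows "\<mu> \<in> sigma_aw A"
proof (rule ccontr)
  define T where "T = op_minus A \<mu>"
  assume "\<mu> \<notin> sigma_aw A"
  moreover have "\<mu> \<in> sigma_a A" using sigma_SBF_subset \<mu> by blast
  ultimately have T: "upper_semi_fredholm T" "\<not> 0 < fredholm_index T"
    by (auto simp: sigma_aw_def T_def)
  have r0: "range (bop_apply (T ^ 0)) = UNIV" by (simp add: one_bop.rep_eq)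
  have at: "upper_semi_b_fredholm_at T 0"
    unfolding upper_semi_b_fredholm_at_def r0 using T(1) by simp
  then have "(LEAST n. upper_semi_b_fredholm_at T n) = 0" by (rule Least_eq_0)
  then have "b_fredholm_index T = fredholm_index T" by (simp only: b_fredholm_index_def r0)
  then show False using \<mu> T(2) at by (auto simp: sigma_SBF_def upper_semi_b_fredholm_def T_def)
qed

text \<open>For the harder direction, a point \<open>\<mu>\<close> of \<open>sigma_a A\<close> outside \<open>sigma_SBF A\<close> and \<open>Pi_a A\<close> would have a
  neighbourhood inside \<open>sigma_a A\<close>, while stability of the index and a-Browder's theorem make the nearby points
  isolated in \<open>sigma_a A\<close>.\<close>

lemma a_browder_iff:
  fixes A :: "'a::complex_banach bop"
  shows "a_browder A \<longleftrightarrow> sigma_SBF A = sigma_a A - Pi_a A"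
proof
  assume g: "sigma_SBF A = sigma_a A - Pi_a A"
  have "\<mu> \<in> sigma_aw A" if \<mu>: "\<mu> \<in> sigma_a A" "\<mu> \<notin> Pi_a0 A" for \<mu>
  proof (rule ccontr)
    assume n: "\<mu> \<notin> sigma_aw A"
    then have "\<mu> \<in> Pi_a A" using sigma_SBF_subset_sigma_aw \<mu>(1) g by blast
    moreover have "alpha (op_minus A \<mu>) < \<infinity>"
      using n \<mu>(1) by (auto simp: sigma_aw_def upper_semi_fredholm_on_def)
    ultimately show False using \<mu>(2) by (simp add: Pi_a0_def)
  qed
  then show "a_browder A" unfolding a_browder_def using sigma_aw_subset by blast
next
  assume br: "a_browder A"
  have "\<mu> \<in> Pi_a A" if \<mu>: "\<mu> \<in> sigma_a A" "\<mu> \<notin> sigma_SBF A" for \<mu>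
  proof (rule ccontr)
    assume "\<mu> \<notin> Pi_a A"
    then obtain \<epsilon>1 where \<epsilon>1: "\<epsilon>1 > 0" "\<And>\<nu>. cmod \<nu> < \<epsilon>1 \<Longrightarrow> \<mu> + \<nu> \<in> sigma_a A"
      using Pi_a_or_eigenvalues[OF \<mu>] by blast
    define T where "T = op_minus A \<mu>"
    define m where "m = (LEAST n. upper_semi_b_fredholm_at T n)"
    have T: "upper_semi_b_fredholm T" "\<not> 0 < b_fredholm_index T"
      using \<mu>(2) by (auto simp: sigma_SBF_def T_def)
    then have at: "upper_semi_b_fredholm_at T m"
      unfolding m_def upper_semi_b_fredholm_def by (blast intro: LeastI_ex)
    have fin: "alpha_on (range (bop_apply (T ^ m))) T < \<infinity>"
      and cl: "closed (range (bop_apply (T ^ m)))" "closed (bop_apply T ` range (bop_apply (T ^ m)))"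
      using at by (auto simp: upper_semi_b_fredholm_at_def upper_semi_fredholm_on_def)
    have "\<not> 0 < index_on (range (bop_apply (T ^ m))) T"
      using T(2) by (simp only: b_fredholm_index_def m_def not_False_eq_True)
    then have "alpha_on (range (bop_apply (T ^ m))) T \<le> beta_on (range (bop_apply (T ^ m))) T"
      unfolding index_on_pos_iff[OF fin] not_less .
    from nonpositive_index_stable[OF cl fin this] obtain \<epsilon>2 where \<epsilon>2: "\<epsilon>2 > 0"
      "\<And>\<nu>. \<nu> \<noteq> 0 \<Longrightarrow> cmod \<nu> < \<epsilon>2 \<Longrightarrow>
        upper_semi_fredholm (op_minus T \<nu>) \<and> alpha (op_minus T \<nu>) \<le> beta (op_minus T \<nu>)"
      by blast
    define \<nu> where "\<nu> = complex_of_real (min \<epsilon>1 \<epsilon>2 / 2)"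
    have \<nu>: "\<nu> \<noteq> 0" "cmod \<nu> < \<epsilon>1" "cmod \<nu> < \<epsilon>2"
      using \<epsilon>1(1) \<epsilon>2(1) by (auto simp: \<nu>_def norm_divide)
    have U: "upper_semi_fredholm (op_minus A (\<mu> + \<nu>))" "alpha (op_minus A (\<mu> + \<nu>)) \<le> beta (op_minus A (\<mu> + \<nu>))"
      using \<epsilon>2(2)[OF \<nu>(1,3)] by (auto simp: T_def op_minus_op_minus)
    then have "\<not> 0 < fredholm_index (op_minus A (\<mu> + \<nu>))"
      by (subst index_on_pos_iff) (auto simp: upper_semi_fredholm_on_def)
    then have "\<mu> + \<nu> \<notin> sigma_aw A" using U(1) by (simp add: sigma_aw_def)
    then have "\<mu> + \<nu> \<in> Pi_a A"
      using br \<epsilon>1(2)[OF \<nu>(2)] by (auto simp: a_browder_def Pi_a0_def)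
    then have "\<mu> + \<nu> \<in> isolated_points (sigma_a A)" by (simp add: Pi_a_def)
    moreover have "\<mu> + \<nu> + \<delta> \<in> sigma_a A" if "cmod \<delta> < \<epsilon>1 - cmod \<nu>" for \<delta>
      using \<epsilon>1(2)[of "\<nu> + \<delta>"] norm_triangle_ineq[of \<nu> \<delta>] that by (simp add: add.assoc)
    ultimately show False
      using not_isolated_if_nhd[of "\<epsilon>1 - cmod \<nu>" "\<mu> + \<nu>" "sigma_a A"] \<nu>(2) by auto
  qed
  then show "sigma_SBF A = sigma_a A - Pi_a A" using sigma_SBF_subset[of A] by blast
qed

lemma generalized_a_weyl_iff:
  fixes A :: "'a::complex_banach bop"
  shows "generalized_a_weyl A \<longleftrightarrow> a_browder A \<and> E_a A = Pi_a A"
  using generalized_a_weyl_imp_E_a_eq[of A] unfolding a_browder_iff generalized_a_weyl_def by auto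

section \<open>Left multiplication operators\<close>

lemma op_minus_left_mult: "op_minus (left_mult A) \<mu> = left_mult (op_minus A \<mu>)"
proof (rule bop_eqI)
  fix T show "bop_apply (op_minus (left_mult A) \<mu>) T = bop_apply (left_mult (op_minus A \<mu>)) T"
    by (rule bop_eqI) (simp add: op_minus_apply left_mult_apply bop_rep_eq)
qed

lemma left_mult_pow: "left_mult A ^ n = left_mult (A ^ n)"
proof (induction n)
  case 0
  show ?case by (rule bop_eqI) (simp add: left_mult_apply bop_rep_eq)
next
  case (Suc n)
  show ?case
    by (rule bop_eqI) (simp add: Suc left_mult_apply bop_rep_eq mult.assoc)
qed

lemma null_space_left_mult: "T \<in> null_space (left_mult B) \<longleftrightarrow> (\<forall>x. bop_apply T x \<in> null_space B)"
proof -
  have "B * T = 0 \<longleftrightarrow> (\<forall>x. bop_apply (B * T) x = 0)"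
    by (metis bop_eqI zero_bop.rep_eq)
  then show ?thesis by (simp add: null_space_on_def left_mult_apply times_bop.rep_eq)
qed

lemma independent_of_card:
  assumes "cdim (UNIV :: 'a::complex_normed_vector set) = \<infinity>"
  obtains E :: "'a::complex_normed_vector set" where "finite E" "card E = k" "\<not> cdependent E"
proof -
  obtain B :: "'a set" where B: "B \<subseteq> UNIV" "\<not> cdependent B" "UNIV \<subseteq> cspan B" "card B = cdim_nat (UNIV :: 'a set)"
    using complex_vector.basis_exists[of UNIV] by blast
  have "infinite B"
  proof
    assume "finite B"
    then have "cdim (UNIV :: 'a set) \<noteq> \<infinity>" using B(3) by (auto simp: cdim_def)
    then show False using assms by blast
  qed
  then obtain E where "finite E" "card E = k" "E \<subseteq> B" using infinite_arbitrarily_large by blast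
  then show ?thesis using that complex_vector.independent_mono[OF B(2)] by blast
qed

context
  fixes A :: "'a::complex_banach bop"
  assumes inf_dim: "cdim (UNIV :: 'a set) = \<infinity>"
begin

lemma normalized_functional_exists: "\<exists>f (e :: 'a). cfunctional f \<and> f e = 1"
proof -
  obtain E :: "'a set" where E: "finite E" "card E = 1" "\<not> cdependent E"
    using independent_of_card[OF inf_dim] by blast
  then obtain e where "e \<in> E" by fastforce
  then show ?thesis using exists_dual_family[OF E(1,3)] by fastforce
qed

text \<open>The operator \<open>rank_one f y\<close> with \<open>f \<noteq> 0\<close> tests whether \<open>y\<close> is in the null space.\<close>

lemma null_space_left_mult_eq_iff:
  fixes B C :: "'a bop"
  shows "null_space (left_mult B) = null_space (left_mult C) \<longleftrightarrow> null_space B = null_space C"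
proof
  assume *: "null_space (left_mult B) = null_space (left_mult C)"
  obtain f and e :: 'a where f: "cfunctional f" "f e = 1" using normalized_functional_exists by blast
  have "rank_one f y \<in> null_space (left_mult D) \<longleftrightarrow> y \<in> null_space D" for D :: "'a bop" and y
    unfolding null_space_left_mult rank_one_apply[OF f(1)]
    using complex_vector.subspace_scale[OF csubspace_null_space_on[of UNIV D]] f(2)
    by (metis complex_vector.subspace_UNIV scaleC_one)
  then show "null_space B = null_space C" using * by blast
qed (auto simp: null_space_left_mult)

lemma null_space_left_mult_trivial_iff:
  fixes B :: "'a bop"
  shows "null_space (left_mult B) = {0} \<longleftrightarrow> null_space B = {0}"
proof -
  have "null_space (1 :: 'a bop) = {0}" by (auto simp: null_space_on_def one_bop.rep_eq)
  moreover have "null_space (left_mult (1 :: 'a bop)) = {0}" by (auto simp: null_space_on_def left_mult_apply)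
  ultimately show ?thesis using null_space_left_mult_eq_iff[of B 1] by simp
qed

text \<open>The map \<open>y \<mapsto> rank_one f y\<close> embeds the range of \<open>B\<close> into that of \<open>left_mult B\<close>, and evaluation at
  \<open>e\<close> with \<open>f e = 1\<close> leads back.\<close>

lemma closed_range_of_left_mult:
  fixes B :: "'a bop"
  assumes cl: "closed (range (bop_apply (left_mult B)))"
  shows "closed (range (bop_apply B))"
  unfolding closed_sequential_limits
proof (intro allI impI, elim conjE)
  fix y l assume y: "\<forall>n. y n \<in> range (bop_apply B)" and l: "y \<longlonglongrightarrow> l"
  obtain f and e :: 'a where f: "cfunctional f" "f e = 1" using normalized_functional_exists by blast
  have bl: "bounded_linear (rank_one f)"
  proof (rule bounded_linear_intro[of _ "onorm f"])
    show "rank_one f (u + v) = rank_one f u + rank_one f v" for u v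
      by (rule bop_eqI) (simp add: rank_one_apply[OF f(1)] bop_rep_eq scaleC_add_right)
    show "rank_one f (r *\<^sub>R u) = r *\<^sub>R rank_one f u" for r u
      by (rule bop_eqI) (simp add: rank_one_apply[OF f(1)] bop_rep_eq scaleR_eq_scaleC scaleC_left_commute)
    show "norm (rank_one f u) \<le> norm u * onorm f" for u
    proof (rule norm_bop_bound)
      have le: "norm (f x) * norm u \<le> onorm f * norm x * norm u" for x
        by (rule mult_right_mono[OF onorm[OF cfunctionalD(1)[OF f(1)]]]) simp
      show "norm (bop_apply (rank_one f u) x) \<le> norm u * onorm f * norm x" for x
        using le[of x] by (simp add: rank_one_apply[OF f(1)] norm_scaleC mult_ac)
    qed (simp add: onorm_pos_le[OF cfunctionalD(1)[OF f(1)]])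
  qed
  have rB: "rank_one f (bop_apply B x) = bop_apply (left_mult B) (rank_one f x)" for x
    by (rule bop_eqI) (simp add: left_mult_apply times_bop.rep_eq rank_one_apply[OF f(1)] bop_apply_scaleC)
  have "rank_one f (y n) \<in> range (bop_apply (left_mult B))" for n
    using y[rule_format, of n] rB by auto
  then have "rank_one f l \<in> range (bop_apply (left_mult B))"
    by (rule closed_sequentially[OF cl _ bounded_linear.tendsto[OF bl l]])
  then obtain S where "rank_one f l = B * S" by (auto simp: left_mult_apply)
  then have "bop_apply (rank_one f l) e = bop_apply B (bop_apply S e)" by (simp add: times_bop.rep_eq)
  then show "l \<in> range (bop_apply B)" by (simp add: rank_one_apply[OF f(1)] f(2) scaleC_one)
qed

lemma bounded_below_left_mult_iff:
  fixes B :: "'a bop"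
  shows "bounded_below (left_mult B) \<longleftrightarrow> bounded_below B"
proof
  assume "bounded_below (left_mult B)"
  then show "bounded_below B"
    using closed_range_of_left_mult by (simp add: bounded_below_def null_space_left_mult_trivial_iff)
next
  assume "bounded_below B"
  then obtain c where c: "c > 0" "\<And>x. c * norm x \<le> norm (bop_apply B x)" by (rule bounded_belowE) blast
  show "bounded_below (left_mult B)"
  proof (rule bounded_belowI[OF c(1)])
    fix S :: "'a bop"
    have "norm S \<le> norm (B * S) / c"
    proof (rule norm_bop_bound)
      fix x
      have "c * norm (bop_apply S x) \<le> norm (B * S) * norm x"
        using c(2)[of "bop_apply S x"] bop_norm_apply[of "B * S" x] by (simp add: times_bop.rep_eq)
      then show "norm (bop_apply S x) \<le> norm (B * S) / c * norm x"
        using c(1) by (simp add: field_simps)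
    qed (use c(1) in simp)
    then show "c * norm S \<le> norm (bop_apply (left_mult B) S)"
      using c(1) by (simp add: left_mult_apply field_simps)
  qed
qed

lemma sigma_a_left_mult: "sigma_a (left_mult A) = sigma_a A"
  by (simp add: sigma_a_def op_minus_left_mult bounded_below_left_mult_iff)

lemma E_a_left_mult: "E_a (left_mult A) = E_a A"
  by (simp add: E_a_def sigma_a_left_mult op_minus_left_mult zero_less_iff_neq_zero alpha_eq_0_iff
      null_space_left_mult_trivial_iff)

lemma left_drazin_of_left_mult:
  fixes B :: "'a bop"
  shows "left_drazin (left_mult B) \<Longrightarrow> left_drazin B"
  unfolding left_drazin_def left_mult_pow null_space_left_mult_eq_iff
  using closed_range_of_left_mult by blast

lemma Pi_a_left_mult_subset: "Pi_a (left_mult A) \<subseteq> Pi_a A"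
  by (auto simp: Pi_a_iff sigma_a_left_mult op_minus_left_mult left_drazin_of_left_mult)

text \<open>A nonzero \<open>y = B\<^sup>n x\<close> in the null space of \<open>B\<close> would give the operators \<open>rank_one f y = B\<^sup>n * rank_one f x\<close>
  for all functionals \<open>f\<close>, and these form an infinite-dimensional space.\<close>

lemma finite_alpha_on_left_mult_imp_stable:
  fixes B :: "'a bop"
  assumes fin: "alpha_on (range (bop_apply (left_mult B ^ n))) (left_mult B) < \<infinity>"
  shows "null_space (B ^ n) = null_space (B ^ Suc n)"
  unfolding null_space_pow_stable_iff
proof (rule ccontr)
  assume "\<not> null_space B \<inter> range (bop_apply (B ^ n)) \<subseteq> {0}"
  then obtain x where x: "bop_apply B (bop_apply (B ^ n) x) = 0" "bop_apply (B ^ n) x \<noteq> 0"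
    by (auto simp: null_space_on_def)
  define y where "y = bop_apply (B ^ n) x"
  obtain F where F: "finite F" "null_space_on (range (bop_apply (left_mult B ^ n))) (left_mult B) \<subseteq> cspan F"
    using fin[unfolded alpha_on_def cdim_finite_iff] by blast
  obtain E :: "'a set" where E: "finite E" "card E = Suc (card F)" "\<not> cdependent E"
    using independent_of_card[OF inf_dim] by blast
  obtain f where f: "\<And>e. e \<in> E \<Longrightarrow> cfunctional (f e)"
    and dual: "\<And>d e. d \<in> E \<Longrightarrow> e \<in> E \<Longrightarrow> f d e = (if d = e then 1 else 0)"
    using exists_dual_family[OF E(1,3)] by blast
  define S where "S e = rank_one (f e) y" for e
  have SE: "bop_apply (S d) e = (if d = e then y else 0)" if "d \<in> E" "e \<in> E" for d e
    using that by (simp add: S_def rank_one_apply f dual scaleC_one)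
  have inj: "inj_on S E"
  proof (rule inj_onI)
    fix d e assume *: "d \<in> E" "e \<in> E" "S d = S e"
    then have "bop_apply (S d) e = y" using SE[of e e] by simp
    then show "d = e" using SE[of d e] * x(2) by (auto simp: y_def split: if_splits)
  qed
  have "\<not> cdependent (S ` E)"
    unfolding complex_vector.dependent_finite[OF finite_imageI[OF E(1)]]
  proof clarify
    fix u d assume u: "(\<Sum>v\<in>S ` E. u v *\<^sub>C v) = 0" and d: "d \<in> E" "u (S d) \<noteq> 0"
    have "0 = bop_apply (\<Sum>v\<in>S ` E. u v *\<^sub>C v) d" using u by (simp add: zero_bop.rep_eq)
    also have "\<dots> = (\<Sum>e\<in>E. u (S e) *\<^sub>C bop_apply (S e) d)"
      unfolding sum_bop_apply sum.reindex[OF inj] by (simp add: scaleC_bop.rep_eq)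
    also have "\<dots> = (\<Sum>e\<in>E. if e = d then u (S e) *\<^sub>C y else 0)"
      by (rule sum.cong) (use d(1) in \<open>auto simp: SE\<close>)
    also have "\<dots> = u (S d) *\<^sub>C y" using d(1) E(1) by simp
    finally have "norm (u (S d) *\<^sub>C y) = 0" by simp
    then show False using d(2) x(2) by (simp add: y_def norm_scaleC)
  qed
  moreover have "S ` E \<subseteq> cspan F"
  proof (rule subset_trans[OF _ F(2)], clarify)
    fix e assume e: "e \<in> E"
    have "S e = bop_apply (left_mult B ^ n) (rank_one (f e) x)"
      by (rule bop_eqI)
        (simp add: S_def left_mult_pow left_mult_apply times_bop.rep_eq rank_one_apply f[OF e] bop_apply_scaleC y_def)
    moreover have "S e \<in> null_space (left_mult B)"
      unfolding null_space_left_mult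
      by (simp add: S_def rank_one_apply f[OF e] null_space_on_def bop_apply_scaleC x(1) y_def)
    ultimately show "S e \<in> null_space_on (range (bop_apply (left_mult B ^ n))) (left_mult B)"
      by (auto simp: null_space_on_def)
  qed
  ultimately have "card (S ` E) \<le> card F"
    using complex_vector.independent_span_bound[OF F(1)] by blast
  then show False using card_image[OF inj] E(2) by simp
qed

lemma a_browder_left_mult: "a_browder (left_mult A)"
  unfolding a_browder_iff
proof (rule antisym[OF sigma_SBF_subset], rule subsetI, rule ccontr)
  fix \<mu> assume \<mu>: "\<mu> \<in> sigma_a (left_mult A) - Pi_a (left_mult A)" "\<mu> \<notin> sigma_SBF (left_mult A)"
  define B where "B = op_minus A \<mu>"
  obtain n where n: "upper_semi_b_fredholm_at (left_mult B) n"
    using \<mu>(2) by (auto simp: sigma_SBF_def upper_semi_b_fredholm_def op_minus_left_mult B_def)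
  have "null_space (left_mult B ^ n) = null_space (left_mult B ^ Suc n)"
    unfolding left_mult_pow null_space_left_mult_eq_iff
    using n by (intro finite_alpha_on_left_mult_imp_stable)
      (simp add: upper_semi_b_fredholm_at_def upper_semi_fredholm_on_def)
  moreover have "closed (range (bop_apply (left_mult B ^ Suc n)))"
    using n unfolding upper_semi_b_fredholm_at_def upper_semi_fredholm_on_def image_range_pow by blast
  ultimately have "left_drazin (left_mult B)" unfolding left_drazin_def by blast
  then show False using \<mu>(1) by (simp add: Pi_a_iff op_minus_left_mult B_def)
qed

end

text \<open>After unfolding generalized a-Weyl's theorem, the chain
  \<open>Pi_a (left_mult A) \<subseteq> Pi_a A \<subseteq> E_a A = E_a (left_mult A)\<close> decides both directions: equality of its
  ends makes all members equal.\<close>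

theorem theorem3p9:
  fixes A :: "'a :: complex_banach bop"
  assumes "cdim (UNIV :: 'a set) = \<infinity>"
  shows "(generalized_a_weyl A \<and> Pi_a A = Pi_a (left_mult A)) \<longleftrightarrow>
    (generalized_a_weyl (left_mult A) \<and> a_browder A)"
  using Pi_a_left_mult_subset[OF assms, of A] Pi_a_subset_E_a[of A]
  unfolding generalized_a_weyl_iff
  by (auto simp: a_browder_left_mult[OF assms] E_a_left_mult[OF assms])

end
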